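(* Let $f,g:\mathbb{R}\to\mathbb{R}$ satisfy: $f,g\in C^\infty(\mathbb{R})$; $f(0)=0$ and $f''(x)\ge 0$ for all $x\in\mathbb{R}$; $g(x)\ge 0$ for all $x\in\mathbb{R}$, and $g(x)=0$ if and only if $x=0$. Let $T>0$, $s>3/2$, and let $u\in C^0([0,T];H^s(\mathbb{R}))$ be a solution of $$u_t+f'(u)u_x+\partial_x\Lambda^{-2}\Big(g(u)+\frac{f''(u)}{2}u_x^2\Big)=0 .$$ For each fixed $t\in[0,T]$ define $$h_t(x)=g(u(t,x))+\frac{f''(u(t,x))}{2}u_x(t,x)^2,\qquad F_t(x)=(\partial_x\Lambda^{-2}h_t)(x).$$ If there exist $t^\ast$ and $a<b$ such that $\{t^\ast\}\times[a,b]\subseteq(0,T)\times\mathbb{R}$, $h_{t^\ast}(x)=0$ for all $x\in(a,b)$, and $F_{t^\ast}(a)=F_{t^\ast}(b)$, then $u\equiv 0$ on $[0,T]\times\mathbb{R}$.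
   Context: Functions are real-valued, $t$ denotes time and $x$ space. $\Lambda^{-2}=(1-\partial_x^2)^{-1}$ is the inverse Helmholtz operator: $\Lambda^{-2}h=p\ast h$ and $\partial_x\Lambda^{-2}h=(\partial_x p)\ast h$, where $p(x)=\tfrac12 e^{-|x|}$, $\partial_xp(x)=-\mathrm{sgn}(x)p(x)$ and $\ast$ is convolution in $x$. $H^s(\mathbb{R})$ is the usual Sobolev space. By local well-posedness theory such solutions also belong to $C^1([0,T];H^{s-1}(\mathbb{R}))$. *)

theory Defs
  imports "HOL-Probability.Probability"
begin

definition smooth :: "(real \<Rightarrow> real) \<Rightarrow> bool" where
  "smooth f \<longleftrightarrow> (\<forall>n. (deriv ^^ n) f differentiable_on UNIV)"

definition square_integrable :: "(real \<Rightarrow> 'a::{banach, second_countable_topology}) \<Rightarrow> bool" where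
  "square_integrable v \<longleftrightarrow>
     v \<in> borel_measurable lborel \<and> integrable lborel (\<lambda>x. (norm (v x))\<^sup>2)"

text \<open>
  Fourier transform on square integrable functions: \<open>w\<close> is the limit in the mean, as
  \<open>R\<close> tends to infinity, of the integrals of \<open>exp (- i x \<xi>) v(x)\<close> over \<open>[-R, R]\<close>.
  This determines \<open>w\<close> only up to a null set. The error is a nonnegative Lebesgue integral,
  which is infinite when the difference is not square integrable.
\<close>

definition has_fourier_transform :: "(real \<Rightarrow> real) \<Rightarrow> (real \<Rightarrow> complex) \<Rightarrow> bool" where
  "has_fourier_transform v w \<longleftrightarrow>
     square_integrable v \<and> square_integrable w \<and>
     ((\<lambda>R. \<integral>\<^sup>+ \<xi>. ennreal
         ((norm ((LINT x:{-R..R}|lborel. exp (- (\<i> * of_real (x * \<xi>))) * of_real (v x)) - w \<xi>))\<^sup>2)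
         \<partial>lborel) \<longlongrightarrow> 0) at_top"

text \<open>
  The space \<open>H\<^sup>s(\<real>)\<close> of real-valued functions, for \<open>s \<ge> 0\<close> (so that it is contained in the
  square integrable functions). Its elements are functions rather than classes modulo
  null sets.
\<close>

definition sobolev_space :: "real \<Rightarrow> (real \<Rightarrow> real) set" where
  "sobolev_space s =
     {v. \<exists>w. has_fourier_transform v w \<and>
           integrable lborel (\<lambda>\<xi>. (1 + \<xi>\<^sup>2) powr s * (norm (w \<xi>))\<^sup>2)}"

text \<open>Independent of the chosen transform, as any two agree almost everywhere.\<close>

definition sobolev_norm :: "real \<Rightarrow> (real \<Rightarrow> real) \<Rightarrow> real" where
  "sobolev_norm s v =
     sqrt (LINT \<xi>|lborel. (1 + \<xi>\<^sup>2) powr s * (norm ((SOME w. has_fourier_transform v w) \<xi>))\<^sup>2)"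

definition continuous_into_sobolev :: "real \<Rightarrow> real \<Rightarrow> (real \<Rightarrow> real \<Rightarrow> real) \<Rightarrow> bool" where
  "continuous_into_sobolev T s u \<longleftrightarrow>
     (\<forall>t\<in>{0..T}. u t \<in> sobolev_space s) \<and>
     (\<forall>t\<in>{0..T}. ((\<lambda>\<tau>. sobolev_norm s (\<lambda>x. u \<tau> x - u t x)) \<longlongrightarrow> 0) (at t within {0..T}))"

definition helmholtz_kernel :: "real \<Rightarrow> real" where
  "helmholtz_kernel x = exp (- \<bar>x\<bar>) / 2"

definition convolve :: "(real \<Rightarrow> real) \<Rightarrow> (real \<Rightarrow> real) \<Rightarrow> real \<Rightarrow> real" where
  "convolve k h x = (LINT y|lborel. k (x - y) * h y)"

text \<open>
  \<open>\<partial>\<^sub>x \<Lambda>\<^sup>-\<^sup>2 h = (\<partial>\<^sub>x p) * h\<close>, where \<open>p\<close> is the kernel above and \<open>\<partial>\<^sub>x p(x) = - sgn(x) p(x)\<close>.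
\<close>

definition dx_inv_helmholtz :: "(real \<Rightarrow> real) \<Rightarrow> real \<Rightarrow> real" where
  "dx_inv_helmholtz h = convolve (\<lambda>x. - sgn x * helmholtz_kernel x) h"

text \<open>In the next two definitions \<open>v\<close> is the profile \<open>u(t, \<cdot>)\<close> at a fixed time.\<close>

definition h_term :: "(real \<Rightarrow> real) \<Rightarrow> (real \<Rightarrow> real) \<Rightarrow> (real \<Rightarrow> real) \<Rightarrow> real \<Rightarrow> real" where
  "h_term f g v x = g (v x) + deriv (deriv f) (v x) / 2 * (deriv v x)\<^sup>2"

definition F_term :: "(real \<Rightarrow> real) \<Rightarrow> (real \<Rightarrow> real) \<Rightarrow> (real \<Rightarrow> real) \<Rightarrow> real \<Rightarrow> real" where
  "F_term f g v = dx_inv_helmholtz (h_term f g v)"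

text \<open>
  The equation is imposed pointwise. A solution in \<open>C\<^sup>0([0,T]; H\<^sup>s)\<close> with \<open>s > 3/2\<close> is also in
  \<open>C\<^sup>1([0,T]; H\<^sup>s\<^sup>-\<^sup>1)\<close>, and both \<open>H\<^sup>s\<^sup>-\<^sup>1\<close> and the \<open>x\<close>-derivatives of elements of \<open>H\<^sup>s\<close> consist of
  continuous bounded functions, so \<open>u\<^sub>t\<close> and \<open>u\<^sub>x\<close> are classical derivatives (one-sided in \<open>t\<close> at
  the ends of the time interval).
\<close>

definition solves_equation ::
  "(real \<Rightarrow> real) \<Rightarrow> (real \<Rightarrow> real) \<Rightarrow> real \<Rightarrow> (real \<Rightarrow> real \<Rightarrow> real) \<Rightarrow> bool" where
  "solves_equation f g T u \<longleftrightarrow>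
     (\<forall>t\<in>{0..T}. \<forall>x. \<exists>u\<^sub>t.
        ((\<lambda>\<tau>. u \<tau> x) has_real_derivative u\<^sub>t) (at t within {0..T}) \<and>
        u\<^sub>t + deriv f (u t x) * deriv (u t) x + dx_inv_helmholtz (h_term f g (u t)) x = 0)"

end

theory Submission
  imports Defs
begin

text \<open>
  Since \<open>F' = \<Lambda>\<^sup>-\<^sup>2 h - h\<close>, on \<open>(a, b)\<close> the function \<open>F\<close> is nondecreasing with derivative
  \<open>\<Lambda>\<^sup>-\<^sup>2 h\<close>, so equal values at \<open>a\<close> and \<open>b\<close> force \<open>\<Lambda>\<^sup>-\<^sup>2 h\<close> to vanish somewhere; the kernel is positive and
  \<open>h \<ge> 0\<close>, hence \<open>h = 0\<close> and \<open>u = 0\<close> at the time \<open>t'\<close>. This propagates to all times, forwards and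
  backwards, because the sup norms of \<open>u\<close> and \<open>u\<^sub>x\<close> satisfy a closed estimate: at a spatial extremum
  of \<open>u\<close> or of a difference quotient \<open>(u(x + \<delta>) - u(x)) / \<delta>\<close> the time derivative is bounded by a
  multiple of those norms, since \<open>h\<close> is, and a maximum principle integrates the bound in time.
  The Sobolev embedding needed to attain the extrema comes from Fourier inversion, tested against
  Gaussians.
\<close>

subsection \<open>Fourier inversion\<close>

text \<open>The obstacle is regularity: \<open>s > 3 / 2\<close> gives only one continuous bounded
  space derivative, so the equation cannot be differentiated in x. Bounds on difference quotients
  that are uniform in their step \<open>\<delta>\<close> pass to the slope of \<open>u\<close> in
  the limit. The estimate closes because the source is linear in the current size \<open>m\<close>:
  \<open>g 0 = 0\<close> gives a bound of \<open>g z\<close> by L times the modulus of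
  \<open>z\<close>, and the squared slope is at most \<open>M * m\<close>, where \<open>M\<close>
  bounds \<open>u\<close> and its slope on all of [0, T]. A time step of length 1 / (4 L (1 + M))
  then halves \<open>m\<close>. This length does not shrink with \<open>m\<close>, so halving can be
  repeated on the same time interval, and finitely many such intervals cover [0, T]. Time
  derivatives are bounded in modulus, so the direction of time is irrelevant. An extremum over the
  whole line is attained only if there is decay at infinity, which square integrability and a
  Lipschitz bound supply. The transform is merely a limit in the mean; pairing it with a Gaussian
  turns that limit into convergence of numbers, and Fubini applies to the truncated
  integrals.\<close>

lemma norm_integral_mult_le:
  fixes d \<phi> :: "'a \<Rightarrow> complex"
  assumes [measurable]: "d \<in> borel_measurable M" "\<phi> \<in> borel_measurable M"
    and \<phi>: "integrable M (\<lambda>x. (norm (\<phi> x))\<^sup>2)" and int: "integrable M (\<lambda>x. d x * \<phi> x)"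
    and c: "c > 0" and A: "A = (LINT x|M. (norm (\<phi> x))\<^sup>2)"
  shows "ennreal (norm (LINT x|M. d x * \<phi> x)) \<le>
    ennreal (c / 2) * (\<integral>\<^sup>+x. ennreal ((norm (d x))\<^sup>2) \<partial>M) + ennreal (A / (2 * c))"
proof -
  have "ennreal (norm (LINT x|M. d x * \<phi> x)) \<le> (\<integral>\<^sup>+x. norm (d x * \<phi> x) \<partial>M)"
    by (rule integral_norm_bound_ennreal[OF int])
  also have "\<dots> \<le> (\<integral>\<^sup>+x. ennreal (c / 2) * ennreal ((norm (d x))\<^sup>2) + ennreal (1 / (2 * c) * (norm (\<phi> x))\<^sup>2) \<partial>M)"
  proof (rule nn_integral_mono)
    fix x
    \<comment> \<open>Young's inequality with weight \<open>c\<close>. The integral of the squared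
      \<open>d\<close> stays in \<open>ennreal\<close>, since nothing says yet that it is
      finite.\<close>
    have "0 \<le> (c * norm (d x) - norm (\<phi> x))\<^sup>2 / (2 * c)" using c by simp
    also have "\<dots> = c / 2 * (norm (d x))\<^sup>2 + 1 / (2 * c) * (norm (\<phi> x))\<^sup>2 - norm (d x * \<phi> x)"
      using c by (simp add: power2_eq_square field_simps norm_mult)
    finally show "ennreal (norm (d x * \<phi> x)) \<le> ennreal (c / 2) * ennreal ((norm (d x))\<^sup>2) + ennreal (1 / (2 * c) * (norm (\<phi> x))\<^sup>2)"
      using c by (simp add: ennreal_mult'[symmetric] ennreal_plus[symmetric] del: ennreal_plus)
  qed
  also have "\<dots> = ennreal (c / 2) * (\<integral>\<^sup>+x. ennreal ((norm (d x))\<^sup>2) \<partial>M) + (\<integral>\<^sup>+x. ennreal (1 / (2 * c) * (norm (\<phi> x))\<^sup>2) \<partial>M)"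
    by (subst nn_integral_add) (auto simp: nn_integral_cmult)
  also have "(\<integral>\<^sup>+x. ennreal (1 / (2 * c) * (norm (\<phi> x))\<^sup>2) \<partial>M) = ennreal (A / (2 * c))"
    using c \<phi> by (subst nn_integral_eq_integral) (auto simp: A)
  finally show ?thesis .
qed

lemma tendsto_integral_mult_L2:
  fixes W :: "real \<Rightarrow> 'a \<Rightarrow> complex"
  assumes lim: "((\<lambda>R. \<integral>\<^sup>+x. ennreal ((norm (W R x - w x))\<^sup>2) \<partial>M) \<longlongrightarrow> 0) F"
    and [measurable]: "\<And>R. W R \<in> borel_measurable M" "w \<in> borel_measurable M" "\<phi> \<in> borel_measurable M"
    and \<phi>: "integrable M (\<lambda>x. (norm (\<phi> x))\<^sup>2)"
    and int: "\<And>R. integrable M (\<lambda>x. W R x * \<phi> x)" "integrable M (\<lambda>x. w x * \<phi> x)"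
  shows "((\<lambda>R. LINT x|M. W R x * \<phi> x) \<longlongrightarrow> (LINT x|M. w x * \<phi> x)) F"
proof (rule tendstoI)
  fix e :: real assume e: "e > 0"
  define A where "A = (LINT x|M. (norm (\<phi> x))\<^sup>2)"
  have A0: "A \<ge> 0" unfolding A_def by simp
  \<comment> \<open>Makes the fixed term \<open>A / (2 * c)\<close> smaller than
    \<open>e / 2\<close>; the \<open>+ 1\<close> keeps \<open>c\<close> positive when
    \<open>A = 0\<close>. The vanishing error, once below \<open>e / c\<close>, contributes the
    other half.\<close>
  define c where "c = (A + 1) / e"
  have c: "c > 0" using A0 e by (simp add: c_def)
  have "eventually (\<lambda>R. (\<integral>\<^sup>+x. ennreal ((norm (W R x - w x))\<^sup>2) \<partial>M) < ennreal (e / c)) F"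
    using order_tendstoD(2)[OF lim, of "ennreal (e / c)"] e c by simp
  then show "eventually (\<lambda>R. dist (LINT x|M. W R x * \<phi> x) (LINT x|M. w x * \<phi> x) < e) F"
  proof eventually_elim
    case (elim R)
    let ?D = "LINT x|M. (W R x - w x) * \<phi> x"
    have "(LINT x|M. W R x * \<phi> x) - (LINT x|M. w x * \<phi> x) = ?D"
      using Bochner_Integration.integral_diff[OF int(1)[of R] int(2)] by (simp add: left_diff_distrib)
    then have eq: "dist (LINT x|M. W R x * \<phi> x) (LINT x|M. w x * \<phi> x) = norm ?D"
      by (simp add: dist_norm)
    have "ennreal (norm ?D) \<le>
       ennreal (c / 2) * (\<integral>\<^sup>+x. ennreal ((norm (W R x - w x))\<^sup>2) \<partial>M) + ennreal (A / (2 * c))"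
      by (rule norm_integral_mult_le[OF _ _ \<phi> _ c A_def])
         (auto simp: left_diff_distrib intro!: Bochner_Integration.integrable_diff int)
    also have "\<dots> \<le> ennreal (c / 2) * ennreal (e / c) + ennreal (A / (2 * c))"
      using elim by (intro add_mono mult_left_mono) auto
    also have "\<dots> = ennreal (e / 2 + A / (2 * c))"
      using c e A0 by (simp add: ennreal_mult'[symmetric] ennreal_plus[symmetric] del: ennreal_plus)
    finally have "norm ?D \<le> e / 2 + A / (2 * c)"
      using c e A0 by (subst (asm) ennreal_le_iff) auto
    also have "A / (2 * c) < e / 2"
      using e A0 by (simp add: c_def field_simps)
    finally show ?case by (simp add: eq)
  qed
qed

text \<open>The characteristic function of the standard normal distribution at
  \<open>x / \<sigma>\<close>, after the substitution of \<open>\<sigma> * \<xi>\<close> for the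
  integration variable.\<close>

lemma gaussian_fourier:
  assumes "\<sigma> > 0"
  shows "(LINT \<xi>|lborel. iexp (x * \<xi>) * of_real (exp (- (\<sigma> * \<xi>)\<^sup>2 / 2))) =
     of_real (sqrt (2 * pi) / \<sigma> * exp (- (x / \<sigma>)\<^sup>2 / 2))"
proof -
  have "of_real (exp (- (x / \<sigma>)\<^sup>2 / 2)) = char std_normal_distribution (x / \<sigma>)"
    by (simp add: char_std_normal_distribution)
  also have "\<dots> = (LINT z|lborel. std_normal_density z *\<^sub>R iexp (x / \<sigma> * z))"
    unfolding char_def by (subst integral_density) auto
  also have "\<dots> = \<bar>\<sigma>\<bar> *\<^sub>R (LINT \<xi>|lborel. std_normal_density (0 + \<sigma> * \<xi>) *\<^sub>R iexp (x / \<sigma> * (0 + \<sigma> * \<xi>)))"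
    using assms by (intro lborel_integral_real_affine) auto
  also have "\<dots> = \<sigma> *\<^sub>R (LINT \<xi>|lborel. (1 / sqrt (2 * pi)) *\<^sub>R (iexp (x * \<xi>) * of_real (exp (- (\<sigma> * \<xi>)\<^sup>2 / 2))))"
    using assms by (simp add: std_normal_density_def scaleR_conv_of_real mult_ac)
  also have "\<dots> = (\<sigma> / sqrt (2 * pi)) *\<^sub>R (LINT \<xi>|lborel. iexp (x * \<xi>) * of_real (exp (- (\<sigma> * \<xi>)\<^sup>2 / 2)))"
    by (simp only: integral_scaleR_right scaleR_scaleR) simp
  finally show ?thesis using assms 
    by (simp add: scaleR_conv_of_real field_simps)
qed

lemma integrable_gaussian:
  assumes "c > (0::real)"
  shows "integrable lborel (\<lambda>x. exp (- c * (x - y)\<^sup>2))"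
proof -
  have "integrable lborel (normal_density y (1 / sqrt (2 * c)))"
    using assms by simp
  then have "integrable lborel (\<lambda>x. sqrt (2 * pi * (1 / sqrt (2 * c))\<^sup>2) * normal_density y (1 / sqrt (2 * c)) x)"
    by simp
  also have "(\<lambda>x. sqrt (2 * pi * (1 / sqrt (2 * c))\<^sup>2) * normal_density y (1 / sqrt (2 * c)) x) = (\<lambda>x. exp (- c * (x - y)\<^sup>2))"
    using assms by (auto simp: normal_density_def field_simps)
  finally show ?thesis .
qed

lemma square_integrable_mult:
  fixes v G :: "'a \<Rightarrow> real"
  assumes [measurable]: "v \<in> borel_measurable M" "G \<in> borel_measurable M"
    and "integrable M (\<lambda>x. (v x)\<^sup>2)" "integrable M (\<lambda>x. (G x)\<^sup>2)"
  shows "integrable M (\<lambda>x. v x * G x)"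
proof (rule Bochner_Integration.integrable_bound)
  show "integrable M (\<lambda>x. (v x)\<^sup>2 + (G x)\<^sup>2)" using assms by simp
  have "\<bar>v x * G x\<bar> \<le> (v x)\<^sup>2 + (G x)\<^sup>2" for x
  proof -
    have "2 * (\<bar>v x\<bar> * \<bar>G x\<bar>) \<le> (v x)\<^sup>2 + (G x)\<^sup>2"
      using sum_squares_bound[of "\<bar>v x\<bar>" "\<bar>G x\<bar>"] by simp
    moreover have "0 \<le> \<bar>v x\<bar> * \<bar>G x\<bar>" by simp
    ultimately show ?thesis unfolding abs_mult by linarith
  qed
  then show "AE x in M. norm (v x * G x) \<le> norm ((v x)\<^sup>2 + (G x)\<^sup>2)" by auto
qed auto

text \<open>Truncation makes \<open>v\<close> integrable, so the integrand is absolutely integrable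
  in both variables and Fubini moves the Gaussian from the frequency side to the space side.\<close>

lemma fourier_pairing:
  assumes v: "square_integrable v" and \<sigma>: "\<sigma> > 0"
  shows "(LINT \<xi>|lborel. (LINT x:{-R..R}|lborel. exp (- (\<i> * of_real (x * \<xi>))) * of_real (v x)) *
            (iexp (y * \<xi>) * of_real (exp (- (\<sigma> * \<xi>)\<^sup>2 / 2)))) =
     of_real (LINT x:{-R..R}|lborel. v x * (sqrt (2 * pi) / \<sigma> * exp (- ((y - x) / \<sigma>)\<^sup>2 / 2)))"
    (is "?lhs = _") and
    "integrable lborel (\<lambda>\<xi>. (LINT x:{-R..R}|lborel. exp (- (\<i> * of_real (x * \<xi>))) * of_real (v x)) *
            (iexp (y * \<xi>) * of_real (exp (- (\<sigma> * \<xi>)\<^sup>2 / 2))))"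
proof -
  have [measurable]: "v \<in> borel_measurable lborel" and v2: "integrable lborel (\<lambda>x. (v x)\<^sup>2)"
    using v by (auto simp: square_integrable_def)
  let ?E = "\<lambda>\<xi>. exp (- (\<sigma> * \<xi>)\<^sup>2 / 2)"
  define f where "f x \<xi> = indicator {-R..R} x *\<^sub>R (exp (- (\<i> * of_real (x * \<xi>))) * of_real (v x)) *
    (iexp (y * \<xi>) * of_real (?E \<xi>))" for x \<xi> :: real
  have vi: "integrable lborel (\<lambda>x. indicator {-R..R} x * \<bar>v x\<bar>)"
  proof (rule Bochner_Integration.integrable_bound)
    show "integrable lborel (\<lambda>x. indicator {-R..R} x + (v x)\<^sup>2)"
      using v2 by (intro Bochner_Integration.integrable_add integrable_real_indicator)
        (auto simp: emeasure_lborel_Icc_eq)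
    \<comment> \<open>Square integrability gives integrability on bounded intervals, where the
      constant 1 is integrable.\<close>
    have "\<bar>v x\<bar> \<le> 1 + (v x)\<^sup>2" for x
      using zero_le_power2[of "\<bar>v x\<bar> - 1"] unfolding power2_diff by simp
    then show "AE x in lborel. norm (indicator {-R..R} x * \<bar>v x\<bar>) \<le> norm (indicator {-R..R} x + (v x)\<^sup>2)"
      by (auto simp: indicator_def)
  qed auto
  have E: "integrable lborel ?E"
    using integrable_gaussian[of "\<sigma>\<^sup>2 / 2" 0] \<sigma> by (simp add: power_mult_distrib)
  have nf: "norm (f x \<xi>) = indicator {-R..R} x * \<bar>v x\<bar> * ?E \<xi>" for x \<xi>
    unfolding f_def norm_mult norm_scaleR norm_exp_eq_Re norm_of_real by simp
  have int: "integrable (lborel \<Otimes>\<^sub>M lborel) (case_prod f)"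
  proof (rule lborel_pair.Fubini_integrable)
    show "case_prod f \<in> borel_measurable (lborel \<Otimes>\<^sub>M lborel)"
      unfolding f_def by measurable
    show "integrable lborel (\<lambda>x. LINT y|lborel. norm (case (x, y) of (x, xa) \<Rightarrow> f x xa))"
      using vi by (simp add: nf)
    have "integrable lborel (f x)" for x
    proof (rule Bochner_Integration.integrable_bound)
      show "integrable lborel (\<lambda>\<xi>. indicator {-R..R} x * \<bar>v x\<bar> * ?E \<xi>)" using E by simp
      show "f x \<in> borel_measurable lborel" unfolding f_def by measurable
    qed (simp add: nf)
    then show "AE x in lborel. integrable lborel (\<lambda>y. case (x, y) of (x, xa) \<Rightarrow> f x xa)" by simp
  qed
  have inner: "(LINT \<xi>|lborel. f x \<xi>) = of_real (indicator {-R..R} x *\<^sub>R (v x * (sqrt (2 * pi) / \<sigma> * exp (- ((y - x) / \<sigma>)\<^sup>2 / 2))))" for x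
  proof -
    have e: "exp (- (\<i> * complex_of_real (x * \<xi>))) * iexp (y * \<xi>) = iexp ((y - x) * \<xi>)" for \<xi>
      by (simp add: exp_add[symmetric] algebra_simps)
    have "f x = (\<lambda>\<xi>. of_real (indicator {-R..R} x * v x) * (iexp ((y - x) * \<xi>) * of_real (?E \<xi>)))"
      unfolding f_def e[symmetric] by (rule ext) (simp only: scaleR_conv_of_real of_real_mult mult_ac)
    then show ?thesis by (simp only: integral_mult_right_zero gaussian_fourier[OF \<sigma>]) simp
  qed
  have outer: "(\<lambda>\<xi>. LINT x|lborel. f x \<xi>) = (\<lambda>\<xi>. (LINT x:{-R..R}|lborel. exp (- (\<i> * of_real (x * \<xi>))) * of_real (v x)) *
            (iexp (y * \<xi>) * of_real (?E \<xi>)))"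
    unfolding f_def set_lebesgue_integral_def by (rule ext) (rule integral_mult_left_zero)
  show "?lhs = of_real (LINT x:{-R..R}|lborel. v x * (sqrt (2 * pi) / \<sigma> * exp (- ((y - x) / \<sigma>)\<^sup>2 / 2)))"
    using lborel_pair.Fubini_integral[OF int] unfolding outer inner integral_complex_of_real
    by (simp only: set_lebesgue_integral_def)
  show "integrable lborel (\<lambda>\<xi>. (LINT x:{-R..R}|lborel. exp (- (\<i> * of_real (x * \<xi>))) * of_real (v x)) *
            (iexp (y * \<xi>) * of_real (?E \<xi>)))"
    using lborel_pair.integrable_snd[OF int] unfolding outer .
qed

text \<open>Lets R tend to infinity in \<open>fourier_pairing\<close>. On the left, convergence in
  the mean suffices against a square integrable test function; on the right, \<open>v\<close> times
  a Gaussian is integrable and dominates.\<close>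

lemma fourier_gaussian_mean:
  assumes vw: "has_fourier_transform v w" and w: "integrable lborel w" and \<sigma>: "\<sigma> > 0"
  shows "(LINT \<xi>|lborel. w \<xi> * (iexp (y * \<xi>) * of_real (exp (- (\<sigma> * \<xi>)\<^sup>2 / 2)))) =
     of_real (LINT x|lborel. v x * (sqrt (2 * pi) / \<sigma> * exp (- ((y - x) / \<sigma>)\<^sup>2 / 2)))"
proof -
  have v: "square_integrable v" and
     lim: "((\<lambda>R. \<integral>\<^sup>+ \<xi>. ennreal
         ((norm ((LINT x:{-R..R}|lborel. exp (- (\<i> * of_real (x * \<xi>))) * of_real (v x)) - w \<xi>))\<^sup>2)
         \<partial>lborel) \<longlongrightarrow> 0) at_top"
    using vw by (auto simp: has_fourier_transform_def)
  have [measurable]: "v \<in> borel_measurable lborel" and v2: "integrable lborel (\<lambda>x. (v x)\<^sup>2)"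
    using v by (auto simp: square_integrable_def)
  have [measurable]: "w \<in> borel_measurable lborel" using w by auto
  let ?\<phi> = "\<lambda>\<xi>. iexp (y * \<xi>) * complex_of_real (exp (- (\<sigma> * \<xi>)\<^sup>2 / 2))"
  let ?G = "\<lambda>x. sqrt (2 * pi) / \<sigma> * exp (- ((y - x) / \<sigma>)\<^sup>2 / 2)"
  have n\<phi>: "norm (?\<phi> \<xi>) = exp (- (\<sigma> * \<xi>)\<^sup>2 / 2)" for \<xi>
    by (simp add: norm_mult norm_exp_i_times del: of_real_mult)
  have \<phi>2: "integrable lborel (\<lambda>\<xi>. (norm (?\<phi> \<xi>))\<^sup>2)"
    unfolding n\<phi> exp_double[symmetric]
    using integrable_gaussian[of "\<sigma>\<^sup>2" 0] \<sigma> by (simp add: power_mult_distrib)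
  have int: "integrable lborel (\<lambda>\<xi>. w \<xi> * ?\<phi> \<xi>)"
  proof (rule Bochner_Integration.integrable_bound[OF w])
    show "AE \<xi> in lborel. norm (w \<xi> * ?\<phi> \<xi>) \<le> norm (w \<xi>)"
      unfolding norm_mult[of "w _"] n\<phi> by (intro AE_I2 mult_left_le) auto
  qed measurable
  have 1: "((\<lambda>R. LINT \<xi>|lborel. (LINT x:{-R..R}|lborel. exp (- (\<i> * of_real (x * \<xi>))) * of_real (v x)) * ?\<phi> \<xi>)
      \<longlongrightarrow> (LINT \<xi>|lborel. w \<xi> * ?\<phi> \<xi>)) at_top"
    by (rule tendsto_integral_mult_L2[OF lim _ _ _ \<phi>2 fourier_pairing(2)[OF v \<sigma>] int])
       (unfold set_lebesgue_integral_def, measurable)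
  have G2: "integrable lborel (\<lambda>x. (?G x)\<^sup>2)"
  proof -
    have "integrable lborel (\<lambda>x. (sqrt (2 * pi) / \<sigma>)\<^sup>2 * exp (- (1 / \<sigma>\<^sup>2) * (x - y)\<^sup>2))"
      using integrable_gaussian[of "1 / \<sigma>\<^sup>2" y] \<sigma> by simp
    also have "(\<lambda>x. (sqrt (2 * pi) / \<sigma>)\<^sup>2 * exp (- (1 / \<sigma>\<^sup>2) * (x - y)\<^sup>2)) = (\<lambda>x. (?G x)\<^sup>2)"
      unfolding power_mult_distrib exp_double[symmetric]
      by (simp add: power_divide power2_commute[of y])
    finally show ?thesis .
  qed
  have vG: "integrable lborel (\<lambda>x. v x * ?G x)"
    by (rule square_integrable_mult[OF _ _ v2 G2]) measurable
  have "((\<lambda>R. LINT x|lborel. indicator {-R..R} x *\<^sub>R (v x * ?G x)) \<longlongrightarrow> (LINT x|lborel. v x * ?G x)) at_top"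
  proof (rule integral_dominated_convergence_at_top[where w="\<lambda>x. norm (v x * ?G x)"])
    show "AE x in lborel. ((\<lambda>R. indicator {-R..R} x *\<^sub>R (v x * ?G x)) \<longlongrightarrow> v x * ?G x) at_top"
    proof (rule AE_I2, rule tendsto_eventually)
      fix x
      show "\<forall>\<^sub>F R in at_top. indicator {-R..R} x *\<^sub>R (v x * ?G x) = v x * ?G x"
        using eventually_ge_at_top[of "\<bar>x\<bar>"] by eventually_elim (auto simp: indicator_def)
    qed
    show "integrable lborel (\<lambda>x. norm (v x * ?G x))" using vG by (rule integrable_norm)
  qed (auto simp: indicator_def abs_mult)
  then have 2: "((\<lambda>R. complex_of_real (LINT x:{-R..R}|lborel. v x * ?G x)) \<longlongrightarrow> of_real (LINT x|lborel. v x * ?G x)) at_top"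
    unfolding set_lebesgue_integral_def by (intro tendsto_intros)
  show ?thesis
    using tendsto_unique[OF _ 1] 2 unfolding fourier_pairing(1)[OF v \<sigma>] by simp
qed

text \<open>The Gaussians form an approximate identity of mass \<open>2 * pi\<close>. As
  \<open>v\<close> is not known to be bounded on the line, the integral is split: on
  \<open>{y - 1..y + 1}\<close> compactness bounds \<open>v\<close> and rescaling concentrates the
  mass at \<open>y\<close>; outside, the Gaussians are dominated by one square integrable function,
  which can be paired with \<open>v\<close>.\<close>

lemma gaussian_mean_tendsto:
  assumes v: "square_integrable v" and cont: "continuous_on UNIV v"
  shows "(\<lambda>n. LINT x|lborel. v x * (sqrt (2 * pi) / inverse (real (Suc n)) * exp (- ((y - x) / inverse (real (Suc n)))\<^sup>2 / 2)))
    \<longlonglongrightarrow> 2 * pi * v y"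
proof -
  have [measurable]: "v \<in> borel_measurable lborel" and v2: "integrable lborel (\<lambda>x. (v x)\<^sup>2)"
    using v by (auto simp: square_integrable_def)
  define G where "G n x = sqrt (2 * pi) * (real (Suc n) * exp (- (real (Suc n) * (x - y))\<^sup>2 / 2))" for n x
  have [measurable]: "G n \<in> borel_measurable borel" for n unfolding G_def by measurable
  have Geq: "sqrt (2 * pi) / inverse (real (Suc n)) * exp (- ((y - x) / inverse (real (Suc n)))\<^sup>2 / 2) = G n x" for n x
    by (simp add: G_def field_simps power2_commute power_mult_distrib)
  define I :: "real \<Rightarrow> real" where "I = indicator {y - 1..y + 1}"
  have [measurable]: "I \<in> borel_measurable borel" unfolding I_def by measurable
  have I01: "I x = 0 \<or> I x = 1" for x by (simp add: I_def indicator_def)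
  have N: "has_bochner_integral lborel (\<lambda>z. sqrt (2 * pi) * exp (- z\<^sup>2 / 2)) (2 * pi)"
  proof -
    have "has_bochner_integral lborel (\<lambda>z. (2 * pi) * std_normal_density z) (2 * pi * 1)"
      by (intro has_bochner_integral_mult_right) (simp add: has_bochner_integral_iff integral_normal_density)
    also have "(\<lambda>z. (2 * pi) * std_normal_density z) = (\<lambda>z. sqrt (2 * pi) * exp (- z\<^sup>2 / 2))"
      by (auto simp: std_normal_density_def field_simps real_div_sqrt)
    finally show ?thesis by simp
  qed
  have "compact (v ` {y - 1..y + 1})"
    by (intro compact_continuous_image continuous_on_subset[OF cont]) auto
  then have "bounded (v ` {y - 1..y + 1})" by (rule compact_imp_bounded)
  then obtain B where "\<forall>x\<in>{y - 1..y + 1}. \<bar>v x\<bar> \<le> B"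
    unfolding bounded_iff ball_simps real_norm_def by blast
  then have B: "\<bar>v x\<bar> \<le> B" if "x \<in> {y - 1..y + 1}" for x
    using that by blast
  have B0: "B \<ge> 0" using B[of y] by simp
  have near: "(\<lambda>n. LINT x|lborel. I x * v x * G n x) \<longlonglongrightarrow> 2 * pi * v y"
  proof -
    define p where "p n z = I (y + inverse (real (Suc n)) * z) * v (y + inverse (real (Suc n)) * z)" for n z
    have [measurable]: "p n \<in> borel_measurable borel" for n unfolding p_def by measurable
    have eq: "(LINT x|lborel. I x * v x * G n x) = (LINT z|lborel. p n z * (sqrt (2 * pi) * exp (- z\<^sup>2 / 2)))" for n
    proof -
      \<comment> \<open>Substituting \<open>y + z / (n + 1)\<close> for \<open>x\<close> freezes the
        Gaussian, so that only the argument of \<open>v\<close> still depends on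
        \<open>n\<close>.\<close>
      have "(LINT x|lborel. I x * v x * G n x) = \<bar>inverse (real (Suc n))\<bar> *\<^sub>R
         (LINT z|lborel. I (y + inverse (real (Suc n)) * z) * v (y + inverse (real (Suc n)) * z) * G n (y + inverse (real (Suc n)) * z))"
        by (intro lborel_integral_real_affine) auto
      also have "\<dots> = (LINT z|lborel. \<bar>inverse (real (Suc n))\<bar> *\<^sub>R (p n z * G n (y + inverse (real (Suc n)) * z)))"
        unfolding p_def by (rule integral_scaleR_right[symmetric])
      also have "\<dots> = (LINT z|lborel. p n z * (sqrt (2 * pi) * exp (- z\<^sup>2 / 2)))"
      proof (rule Bochner_Integration.integral_cong[OF refl])
        fix z
        have "real (Suc n) * (y + inverse (real (Suc n)) * z - y) = z" by simp
        then show "\<bar>inverse (real (Suc n))\<bar> *\<^sub>R (p n z * G n (y + inverse (real (Suc n)) * z)) =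
            p n z * (sqrt (2 * pi) * exp (- z\<^sup>2 / 2))"
          unfolding G_def by (simp add: mult.assoc[symmetric] del: of_nat_Suc)
      qed
      finally show ?thesis .
    qed
    have "(\<lambda>n. LINT z|lborel. p n z * (sqrt (2 * pi) * exp (- z\<^sup>2 / 2))) \<longlonglongrightarrow> (LINT z|lborel. v y * (sqrt (2 * pi) * exp (- z\<^sup>2 / 2)))"
    proof (rule integral_dominated_convergence[where w="\<lambda>z. B * (sqrt (2 * pi) * exp (- z\<^sup>2 / 2))"])
      show "integrable lborel (\<lambda>z. B * (sqrt (2 * pi) * exp (- z\<^sup>2 / 2)))"
        using N by (simp add: has_bochner_integral_iff)
      show "AE z in lborel. (\<lambda>n. p n z * (sqrt (2 * pi) * exp (- z\<^sup>2 / 2))) \<longlonglongrightarrow> v y * (sqrt (2 * pi) * exp (- z\<^sup>2 / 2))"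
      proof (rule AE_I2)
        fix z :: real
        have l0: "(\<lambda>n. y + inverse (real (Suc n)) * z) \<longlonglongrightarrow> y + 0 * z"
          by (intro tendsto_intros LIMSEQ_inverse_real_of_nat)
        have "(\<lambda>n. v (y + inverse (real (Suc n)) * z)) \<longlonglongrightarrow> v y"
          using continuous_on_tendsto_compose[OF cont l0] by simp
        moreover have "eventually (\<lambda>n. v (y + inverse (real (Suc n)) * z) = p n z) sequentially"
        proof -
          have "eventually (\<lambda>n. dist (y + inverse (real (Suc n)) * z) y < 1) sequentially"
            using tendstoD[OF l0, of 1] by simp
          then show ?thesis
            by eventually_elim (auto simp: p_def I_def indicator_def dist_real_def abs_if split: if_splits)
        qed
        ultimately have "(\<lambda>n. p n z) \<longlonglongrightarrow> v y" by (rule Lim_transform_eventually)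
        then show "(\<lambda>n. p n z * (sqrt (2 * pi) * exp (- z\<^sup>2 / 2))) \<longlonglongrightarrow> v y * (sqrt (2 * pi) * exp (- z\<^sup>2 / 2))"
          by (intro tendsto_intros)
      qed
      have "\<bar>p n z\<bar> \<le> B" for n z
        using B[of "y + inverse (real (Suc n)) * z"] B0 by (auto simp: p_def I_def indicator_def)
      then show "AE z in lborel. norm (p n z * (sqrt (2 * pi) * exp (- z\<^sup>2 / 2))) \<le> B * (sqrt (2 * pi) * exp (- z\<^sup>2 / 2))" for n
        by (intro AE_I2) (simp add: abs_mult mult_right_mono)
    qed auto
    also have "(LINT z|lborel. v y * (sqrt (2 * pi) * exp (- z\<^sup>2 / 2))) = v y * (2 * pi)"
      using N by (subst integral_mult_right_zero) (simp add: has_bochner_integral_iff)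
    finally show ?thesis unfolding eq by (simp add: mult_ac)
  qed
  \<comment> \<open>Half of the exponent absorbs the growing factor \<open>k\<close>, as
    \<open>k\<close> is at most \<open>exp ((k * r)\<^sup>2 / 4)\<close> for \<open>r\<close> of
    modulus at least 1; the other half is largest at \<open>k = 1\<close>, which gives a bound free
    of \<open>n\<close>.\<close>
  have dom: "real (Suc n) * exp (- (real (Suc n) * r)\<^sup>2 / 2) \<le> exp (- (1 / 4) * r\<^sup>2)" if r: "\<bar>r\<bar> \<ge> 1" for n r
  proof -
    define k where "k = real (Suc n)"
    have k: "k \<ge> 1" by (simp add: k_def)
    have r2: "r\<^sup>2 \<ge> 1" using r by (metis abs_le_square_iff abs_one one_power2)
    have k2: "k\<^sup>2 \<ge> 1" using k by simp
    have "k \<le> 1 + k\<^sup>2 / 4" using zero_le_power2[of "k / 2 - 1"] by (simp add: power2_eq_square field_simps)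
    also have "\<dots> \<le> 1 + (k * r)\<^sup>2 / 4" using r2 by (simp add: power_mult_distrib mult_le_cancel_left1)
    also have "\<dots> \<le> exp ((k * r)\<^sup>2 / 4)" by (rule exp_ge_add_one_self)
    finally have "k * exp (- (k * r)\<^sup>2 / 2) \<le> exp ((k * r)\<^sup>2 / 4) * exp (- (k * r)\<^sup>2 / 2)"
      by (intro mult_right_mono) auto
    also have "\<dots> = exp (- (k * r)\<^sup>2 / 4)" by (simp add: exp_add[symmetric])
    also have "\<dots> \<le> exp (- (1 / 4) * r\<^sup>2)" using k2 by (simp add: power_mult_distrib mult_le_cancel_right1)
    finally show ?thesis by (simp add: k_def)
  qed
  have dom': "\<bar>(1 - I x) * v x * G n x\<bar> \<le> \<bar>v x\<bar> * (sqrt (2 * pi) * exp (- (1 / 4) * (x - y)\<^sup>2))" for n x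
  proof (cases "x \<in> {y - 1..y + 1}")
    case False
    then have "\<bar>x - y\<bar> \<ge> 1" by auto
    from dom[OF this, of n] False show ?thesis
      by (simp add: I_def G_def abs_mult mult_left_mono)
  qed (simp add: I_def)
  have "integrable lborel (\<lambda>x. v x * (sqrt (2 * pi) * exp (- (1 / 4) * (x - y)\<^sup>2)))"
  proof (rule square_integrable_mult[OF _ _ v2])
    have "integrable lborel (\<lambda>x. 2 * pi * exp (- (1/2) * (x - y)\<^sup>2))"
      by (intro integrable_mult_right integrable_gaussian) simp
    also have "(\<lambda>x. 2 * pi * exp (- (1/2) * (x - y)\<^sup>2)) = (\<lambda>x. (sqrt (2 * pi) * exp (- (1 / 4) * (x - y)\<^sup>2))\<^sup>2)"
      by (simp add: power_mult_distrib exp_double[symmetric])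
    finally show "integrable lborel (\<lambda>x. (sqrt (2 * pi) * exp (- (1 / 4) * (x - y)\<^sup>2))\<^sup>2)" .
  qed auto
  then have domi: "integrable lborel (\<lambda>x. \<bar>v x\<bar> * (sqrt (2 * pi) * exp (- (1 / 4) * (x - y)\<^sup>2)))"
    by (subst (asm) integrable_abs_iff[symmetric]) (auto simp: abs_mult)
  have far: "(\<lambda>n. LINT x|lborel. (1 - I x) * v x * G n x) \<longlonglongrightarrow> (LINT (x::real)|lborel. 0)"
  proof (rule integral_dominated_convergence[where w="\<lambda>x. \<bar>v x\<bar> * (sqrt (2 * pi) * exp (- (1 / 4) * (x - y)\<^sup>2))"])
    show "integrable lborel (\<lambda>x. \<bar>v x\<bar> * (sqrt (2 * pi) * exp (- (1 / 4) * (x - y)\<^sup>2)))" by (rule domi)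
    show "AE x in lborel. norm ((1 - I x) * v x * G n x) \<le> \<bar>v x\<bar> * (sqrt (2 * pi) * exp (- (1 / 4) * (x - y)\<^sup>2))" for n
      using dom' by auto
    show "AE x in lborel. (\<lambda>n. (1 - I x) * v x * G n x) \<longlonglongrightarrow> 0"
    proof (rule AE_I2)
      fix x :: real
      show "(\<lambda>n. (1 - I x) * v x * G n x) \<longlonglongrightarrow> 0"
      proof (cases "x = y")
        case False
        have "(\<lambda>n. real (Suc n) * exp (- (real (Suc n) * (x - y))\<^sup>2 / 2)) \<longlonglongrightarrow> 0"
        proof (rule tendsto_sandwich)
          show "\<forall>\<^sub>F n in sequentially. 0 \<le> real (Suc n) * exp (- (real (Suc n) * (x - y))\<^sup>2 / 2)" by simp
          show "(\<lambda>n. (2 / (x - y)\<^sup>2) * inverse (real (Suc n))) \<longlonglongrightarrow> 0"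
            using tendsto_mult_left[OF LIMSEQ_inverse_real_of_nat, of "2 / (x - y)\<^sup>2"] by simp
          have "real (Suc n) * exp (- (real (Suc n) * (x - y))\<^sup>2 / 2) \<le> (2 / (x - y)\<^sup>2) * inverse (real (Suc n))" for n
          proof -
            define k where "k = real (Suc n)"
            have k: "k > 0" by (simp add: k_def)
            define q where "q = (k * (x - y))\<^sup>2 / 2"
            have q: "q > 0" using k False by (simp add: q_def)
            have "q \<le> exp q" using exp_ge_add_one_self[of q] by linarith
            then have "exp (- q) \<le> 1 / q" using q by (simp add: exp_minus field_simps)
            then have "k * exp (- q) \<le> k * (1 / q)" using k by (intro mult_left_mono) auto
            also have "\<dots> = (2 / (x - y)\<^sup>2) * inverse k" using k False
              unfolding q_def power_mult_distrib by (simp add: power2_eq_square[of k] divide_simps)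
            finally show ?thesis by (simp add: k_def q_def)
          qed
          then show "\<forall>\<^sub>F n in sequentially. real (Suc n) * exp (- (real (Suc n) * (x - y))\<^sup>2 / 2) \<le> (2 / (x - y)\<^sup>2) * inverse (real (Suc n))"
            by simp
        qed simp
        then have "(\<lambda>n. (1 - I x) * v x * G n x) \<longlonglongrightarrow> (1 - I x) * v x * (sqrt (2 * pi) * 0)"
          unfolding G_def by (intro tendsto_intros)
        then show ?thesis by simp
      qed (simp add: I_def)
    qed
  qed auto
  have "(\<lambda>n. (LINT x|lborel. I x * v x * G n x) + (LINT x|lborel. (1 - I x) * v x * G n x)) \<longlonglongrightarrow> 2 * pi * v y + 0"
    using tendsto_add[OF near far] by simp
  moreover have "(LINT x|lborel. I x * v x * G n x) + (LINT x|lborel. (1 - I x) * v x * G n x) = (LINT x|lborel. v x * G n x)" for n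
  proof -
    have G2: "integrable lborel (\<lambda>x. (G n x)\<^sup>2)"
    proof -
      have "integrable lborel (\<lambda>x. (2 * pi * (real (Suc n))\<^sup>2) * exp (- (real (Suc n))\<^sup>2 * (x - y)\<^sup>2))"
        by (intro integrable_mult_right integrable_gaussian) simp
      also have "(\<lambda>x. (2 * pi * (real (Suc n))\<^sup>2) * exp (- (real (Suc n))\<^sup>2 * (x - y)\<^sup>2)) = (\<lambda>x. (G n x)\<^sup>2)"
        by (simp add: G_def power_mult_distrib exp_double[symmetric] mult.assoc)
      finally show ?thesis .
    qed
    have vG: "integrable lborel (\<lambda>x. v x * G n x)"
      by (rule square_integrable_mult[OF _ _ v2 G2]) measurable
    have "integrable lborel (\<lambda>x. I x * v x * G n x)" "integrable lborel (\<lambda>x. (1 - I x) * v x * G n x)"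
      by (rule Bochner_Integration.integrable_bound[OF vG]; use I01 in \<open>auto simp: abs_mult I_def indicator_def\<close>)+
    then show ?thesis
      by (subst Bochner_Integration.integral_add[symmetric]) (auto simp: algebra_simps)
  qed
  ultimately show ?thesis unfolding Geq by simp
qed

text \<open>Two limits of one sequence as the Gaussian factor flattens to 1: the approximate
  identity gives \<open>2 * pi * v y\<close>, dominated convergence under integrable
  \<open>w\<close> gives the inverse transform. Continuity of \<open>v\<close> is what fixes the
  value at every single point.\<close>

theorem fourier_inversion:
  assumes vw: "has_fourier_transform v w" and w: "integrable lborel w" and cont: "continuous_on UNIV v"
  shows "of_real (2 * pi * v y) = (LINT \<xi>|lborel. w \<xi> * iexp (y * \<xi>))"
proof -
  have v: "square_integrable v" using vw by (simp add: has_fourier_transform_def)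
  have [measurable]: "w \<in> borel_measurable lborel" using w by auto
  have *: "(\<lambda>n. LINT \<xi>|lborel. w \<xi> * (iexp (y * \<xi>) * of_real (exp (- (inverse (real (Suc n)) * \<xi>)\<^sup>2 / 2)))) \<longlonglongrightarrow> of_real (2 * pi * v y)"
    unfolding fourier_gaussian_mean[OF vw w positive_imp_inverse_positive[OF of_nat_0_less_iff[THEN iffD2, OF zero_less_Suc]]]
    by (intro tendsto_of_real gaussian_mean_tendsto[OF v cont])
  have "(\<lambda>n. LINT \<xi>|lborel. w \<xi> * (iexp (y * \<xi>) * of_real (exp (- (inverse (real (Suc n)) * \<xi>)\<^sup>2 / 2)))) \<longlonglongrightarrow> (LINT \<xi>|lborel. w \<xi> * iexp (y * \<xi>))"
  proof (rule integral_dominated_convergence[where w="\<lambda>\<xi>. norm (w \<xi>)"])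
    show "integrable lborel (\<lambda>\<xi>. norm (w \<xi>))" using w by simp
    show "AE \<xi> in lborel. norm (w \<xi> * (iexp (y * \<xi>) * of_real (exp (- (inverse (real (Suc n)) * \<xi>)\<^sup>2 / 2)))) \<le> norm (w \<xi>)" for n
      by (auto simp add: norm_mult norm_exp_i_times intro!: mult_left_le simp del: of_real_mult)
    show "AE \<xi> in lborel. (\<lambda>n. w \<xi> * (iexp (y * \<xi>) * of_real (exp (- (inverse (real (Suc n)) * \<xi>)\<^sup>2 / 2)))) \<longlonglongrightarrow> w \<xi> * iexp (y * \<xi>)"
    proof (rule AE_I2)
      fix \<xi> :: real
      have "(\<lambda>n. w \<xi> * (iexp (y * \<xi>) * of_real (exp (- (inverse (real (Suc n)) * \<xi>)\<^sup>2 / 2)))) \<longlonglongrightarrow> w \<xi> * (iexp (y * \<xi>) * of_real (exp (- (0 * \<xi>)\<^sup>2 / 2)))"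
        by (intro tendsto_intros LIMSEQ_inverse_real_of_nat) auto
      then show "(\<lambda>n. w \<xi> * (iexp (y * \<xi>) * of_real (exp (- (inverse (real (Suc n)) * \<xi>)\<^sup>2 / 2)))) \<longlonglongrightarrow> w \<xi> * iexp (y * \<xi>)"
        by simp
    qed
  qed auto
  then show ?thesis using LIMSEQ_unique[OF *] by simp
qed

subsection \<open>Sobolev embedding\<close>

text \<open>The source of the threshold: for large \<open>\<xi>\<close> the weight decays with power
  \<open>2 - 2 * s\<close>, which is below -1 exactly when \<open>s > 3 / 2\<close>. The exponent is
  \<open>1 - s\<close> instead of \<open>- s\<close> because a derivative costs one factor
  \<open>\<xi>\<close>.\<close>

lemma integrable_sobolev_weight:
  assumes s: "s > 3 / 2"
  shows "integrable lborel (\<lambda>\<xi>::real. (1 + \<xi>\<^sup>2) powr (1 - s))"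
proof -
  define g where "g = (\<lambda>\<xi>::real. \<xi> powr (2 - 2 * s) * indicator {1..} \<xi>)"
  have "has_bochner_integral lborel (\<lambda>\<xi>. \<xi> powr (2 - 2 * s) * indicator {1..} \<xi>) (0 - 1 powr (3 - 2 * s) / (3 - 2 * s))"
  proof (rule has_bochner_integral_nn_integral)
    have "(\<integral>\<^sup>+ \<xi>. ennreal (\<xi> powr (2 - 2 * s)) * indicator {1..} \<xi> \<partial>lborel) = ennreal (0 - 1 powr (3 - 2 * s) / (3 - 2 * s))"
    proof (rule nn_integral_FTC_atLeast[where F="\<lambda>\<xi>. \<xi> powr (3 - 2 * s) / (3 - 2 * s)"])
      have "((\<lambda>\<xi>::real. \<xi> powr (3 - 2 * s)) \<longlongrightarrow> 0) at_top"
        using s by (intro tendsto_neg_powr filterlim_ident) auto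
      then show "((\<lambda>\<xi>. \<xi> powr (3 - 2 * s) / (3 - 2 * s)) \<longlongrightarrow> 0) at_top"
        by (rule tendsto_divide_zero)
      show "((\<lambda>\<xi>. \<xi> powr (3 - 2 * s) / (3 - 2 * s)) has_real_derivative x powr (2 - 2 * s)) (at x)" if "1 \<le> x" for x
        using s that by (auto intro!: derivative_eq_intros simp: divide_simps)
    qed auto
    then show "(\<integral>\<^sup>+ \<xi>. ennreal (\<xi> powr (2 - 2 * s) * indicator {1..} \<xi>) \<partial>lborel) = ennreal (0 - 1 powr (3 - 2 * s) / (3 - 2 * s))"
      by (simp add: ennreal_mult' ennreal_indicator)
  qed (use s in \<open>auto simp: divide_simps\<close>)
  then have g: "integrable lborel g"
    by (simp add: has_bochner_integral_iff g_def)
  \<comment> \<open>The reflected tail covers negative \<open>\<xi>\<close>;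
    \<open>0 + (-1) * \<xi>\<close> is the shape of the affine substitution rule.\<close>
  then have g': "integrable lborel (\<lambda>\<xi>. g (0 + (-1) * \<xi>))"
    by (rule lborel_integrable_real_affine) simp
  show ?thesis
  proof (rule Bochner_Integration.integrable_bound)
    show "integrable lborel (\<lambda>\<xi>. g \<xi> + g (0 + (-1) * \<xi>) + indicator {-1..1} \<xi>)"
      using g g' by (intro Bochner_Integration.integrable_add integrable_real_indicator)
        (auto simp: emeasure_lborel_Icc_eq)
    show "AE \<xi> in lborel. norm ((1 + \<xi>\<^sup>2) powr (1 - s)) \<le> norm (g \<xi> + g (0 + (-1) * \<xi>) + indicator {-1..1} \<xi>)"
    proof (rule AE_I2)
      fix \<xi> :: real
      have gpos: "g x \<ge> 0" for x by (simp add: g_def)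
      show "norm ((1 + \<xi>\<^sup>2) powr (1 - s)) \<le> norm (g \<xi> + g (0 + (-1) * \<xi>) + indicator {-1..1} \<xi>)"
      proof (cases "\<bar>\<xi>\<bar> \<le> 1")
        case True
        have "(1 + \<xi>\<^sup>2) powr (1 - s) \<le> (1 + \<xi>\<^sup>2) powr 0"
          using s by (intro powr_mono) auto
        also have "\<dots> = 1" by (simp add: add_nonneg_eq_0_iff)
        finally show ?thesis using True gpos[of \<xi>] gpos[of "- \<xi>"] by (auto simp: indicator_def abs_le_iff)
      next
        case False
        then have pos: "\<bar>\<xi>\<bar> > 0" by auto
        have "(1 + \<xi>\<^sup>2) powr (1 - s) \<le> (\<xi>\<^sup>2) powr (1 - s)"
          using s pos by (intro powr_mono2') auto
        also have "\<xi>\<^sup>2 = \<bar>\<xi>\<bar> powr 2" using pos by (simp add: powr_numeral)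
        also have "(\<bar>\<xi>\<bar> powr 2) powr (1 - s) = \<bar>\<xi>\<bar> powr (2 - 2 * s)" unfolding powr_powr by (simp add: right_diff_distrib)
        also have "\<dots> \<le> g \<xi> + g (- \<xi>)" using False gpos[of \<xi>] gpos[of "- \<xi>"] by (auto simp: g_def indicator_def abs_le_iff)
        finally show ?thesis using gpos[of \<xi>] gpos[of "- \<xi>"] by (simp add: indicator_def)
      qed
    qed
  qed auto
qed

section \<open>Uniqueness and linearity of the Fourier transform\<close>

lemma square_integrable_truncated:
  assumes v: "square_integrable v"
  shows "set_integrable lborel {-R..R} (\<lambda>x. exp (- (\<i> * complex_of_real (x * \<xi>))) * of_real (v x))"
  unfolding set_integrable_def
proof (rule Bochner_Integration.integrable_bound)
  have [measurable]: "v \<in> borel_measurable lborel" and v2: "integrable lborel (\<lambda>x. (v x)\<^sup>2)"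
    using v by (auto simp: square_integrable_def)
  show "integrable lborel (\<lambda>x. indicator {-R..R} x + (v x)\<^sup>2)"
    using v2 by (intro Bochner_Integration.integrable_add integrable_real_indicator)
      (auto simp: emeasure_lborel_Icc_eq)
  show "(\<lambda>x. indicator {-R..R} x *\<^sub>R (exp (- (\<i> * complex_of_real (x * \<xi>))) * of_real (v x))) \<in> borel_measurable lborel"
    by measurable
  have n: "norm (exp (- (\<i> * complex_of_real (x * \<xi>)))) = 1" for x
    unfolding norm_exp_eq_Re by simp
  have "\<bar>v x\<bar> \<le> 1 + (v x)\<^sup>2" for x
    using zero_le_power2[of "\<bar>v x\<bar> - 1"] unfolding power2_diff by simp
  then show "AE x in lborel. norm (indicator {-R..R} x *\<^sub>R (exp (- (\<i> * complex_of_real (x * \<xi>))) * of_real (v x)))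
      \<le> norm (indicator {-R..R} x + (v x)\<^sup>2)"
    unfolding norm_scaleR norm_mult n by (auto simp: indicator_def)
qed

lemma norm_diff_square_le:
  fixes a b :: "'a :: real_normed_vector"
  shows "(norm (a - b))\<^sup>2 \<le> 2 * (norm a)\<^sup>2 + 2 * (norm b)\<^sup>2"
proof -
  have "(norm (a - b))\<^sup>2 \<le> (norm a + norm b)\<^sup>2"
    by (intro power_mono norm_triangle_ineq4) auto
  also have "\<dots> \<le> 2 * (norm a)\<^sup>2 + 2 * (norm b)\<^sup>2"
    using zero_le_power2[of "norm a - norm b"] by (simp add: power2_eq_square algebra_simps)
  finally show ?thesis .
qed

text \<open>Stands in for the triangle inequality in the mean square norm. Comparing squares at the
  price of a factor 2 avoids roots and allows infinite values.\<close>

lemma nn_integral_norm_diff_square_le: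
  fixes a b :: "'a \<Rightarrow> complex"
  assumes [measurable]: "a \<in> borel_measurable M" "b \<in> borel_measurable M"
  shows "(\<integral>\<^sup>+x. ennreal ((norm (a x - b x))\<^sup>2) \<partial>M) \<le>
    2 * (\<integral>\<^sup>+x. ennreal ((norm (a x))\<^sup>2) \<partial>M) + 2 * (\<integral>\<^sup>+x. ennreal ((norm (b x))\<^sup>2) \<partial>M)"
proof -
  have "(\<integral>\<^sup>+x. ennreal ((norm (a x - b x))\<^sup>2) \<partial>M) \<le>
      (\<integral>\<^sup>+x. 2 * ennreal ((norm (a x))\<^sup>2) + 2 * ennreal ((norm (b x))\<^sup>2) \<partial>M)"
    using norm_diff_square_le[of "a _" "b _"]
    by (intro nn_integral_mono) (simp add: ennreal_plus[symmetric] ennreal_mult''[symmetric] ennreal_numeral[symmetric] del: ennreal_plus ennreal_numeral)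
  also have "\<dots> = 2 * (\<integral>\<^sup>+x. ennreal ((norm (a x))\<^sup>2) \<partial>M) + 2 * (\<integral>\<^sup>+x. ennreal ((norm (b x))\<^sup>2) \<partial>M)"
    by (subst nn_integral_add) (auto simp: nn_integral_cmult)
  finally show ?thesis .
qed

lemma borel_measurable_truncated:
  assumes "square_integrable v"
  shows "(\<lambda>\<xi>. LINT x:{-R..R}|lborel. exp (- (\<i> * complex_of_real (x * \<xi>))) * of_real (v x)) \<in> borel_measurable lborel"
proof -
  have [measurable]: "v \<in> borel_measurable lborel" using assms by (simp add: square_integrable_def)
  show ?thesis unfolding set_lebesgue_integral_def by measurable
qed

text \<open>Both candidates are mean square limits of the same truncated integrals. This makes the
  choice by \<open>SOME\<close> in \<open>sobolev_norm\<close> harmless.\<close>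

lemma has_fourier_transform_unique:
  assumes "has_fourier_transform v w" "has_fourier_transform v w'"
  shows "AE \<xi> in lborel. w \<xi> = w' \<xi>"
proof -
  let ?a = "\<lambda>R \<xi>. LINT x:{-R..R}|lborel. exp (- (\<i> * complex_of_real (x * \<xi>))) * of_real (v x)"
  have mw[measurable]: "w \<in> borel_measurable lborel" "w' \<in> borel_measurable lborel"
    using assms by (auto simp: has_fourier_transform_def square_integrable_def)
  have ma: "?a R \<in> borel_measurable lborel" for R
    using assms(1) by (intro borel_measurable_truncated) (simp add: has_fourier_transform_def)
  let ?I = "\<lambda>R w. \<integral>\<^sup>+ \<xi>. ennreal ((norm (?a R \<xi> - w \<xi>))\<^sup>2) \<partial>lborel"
  have lim: "((\<lambda>R. ?I R w) \<longlongrightarrow> 0) at_top" "((\<lambda>R. ?I R w') \<longlongrightarrow> 0) at_top"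
    using assms by (simp_all only: has_fourier_transform_def)
  have "((\<lambda>R. 2 * ?I R w' + 2 * ?I R w) \<longlongrightarrow> 2 * 0 + 2 * 0) at_top"
    by (intro tendsto_add ennreal_tendsto_cmult lim) auto
  moreover have "(\<integral>\<^sup>+ \<xi>. ennreal ((norm (w \<xi> - w' \<xi>))\<^sup>2) \<partial>lborel) \<le> 2 * ?I R w' + 2 * ?I R w" for R
  proof -
    have d: "(?a R \<xi> - w' \<xi>) - (?a R \<xi> - w \<xi>) = w \<xi> - w' \<xi>" for \<xi> by simp
    show ?thesis
      using nn_integral_norm_diff_square_le[OF borel_measurable_diff[OF ma mw(2)] borel_measurable_diff[OF ma mw(1)], of R R]
      unfolding d .
  qed
  ultimately have "(\<integral>\<^sup>+ \<xi>. ennreal ((norm (w \<xi> - w' \<xi>))\<^sup>2) \<partial>lborel) \<le> 2 * 0 + 2 * 0"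
    by (intro tendsto_lowerbound[where F=at_top and f="\<lambda>R. 2 * ?I R w' + 2 * ?I R w"]) auto
  then have "(\<integral>\<^sup>+ \<xi>. ennreal ((norm (w \<xi> - w' \<xi>))\<^sup>2) \<partial>lborel) = 0" by simp
  then show ?thesis by (subst (asm) nn_integral_0_iff_AE) (auto simp: ennreal_eq_0_iff)
qed

lemma square_integrable_diff:
  fixes v v' :: "real \<Rightarrow> 'a :: {banach, second_countable_topology}"
  assumes "square_integrable v" "square_integrable v'"
  shows "square_integrable (\<lambda>x. v x - v' x)"
proof -
  have [measurable]: "v \<in> borel_measurable lborel" "v' \<in> borel_measurable lborel"
    and i: "integrable lborel (\<lambda>x. (norm (v x))\<^sup>2)" "integrable lborel (\<lambda>x. (norm (v' x))\<^sup>2)"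
    using assms by (auto simp: square_integrable_def)
  have "integrable lborel (\<lambda>x. (norm (v x - v' x))\<^sup>2)"
  proof (rule Bochner_Integration.integrable_bound)
    show "integrable lborel (\<lambda>x. 2 * (norm (v x))\<^sup>2 + 2 * (norm (v' x))\<^sup>2)" using i by simp
    show "AE x in lborel. norm ((norm (v x - v' x))\<^sup>2) \<le> norm (2 * (norm (v x))\<^sup>2 + 2 * (norm (v' x))\<^sup>2)"
      using norm_diff_square_le[of "v _" "v' _"] by auto
  qed measurable
  then show ?thesis by (auto simp: square_integrable_def)
qed

text \<open>Continuity in time is expressed through the norm of a difference, so the embedding has
  to be applied to differences.\<close>

lemma has_fourier_transform_diff:
  assumes "has_fourier_transform v w" "has_fourier_transform v' w'"
  shows "has_fourier_transform (\<lambda>x. v x - v' x) (\<lambda>\<xi>. w \<xi> - w' \<xi>)"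
proof -
  have sq: "square_integrable v" "square_integrable v'" "square_integrable w" "square_integrable w'"
    using assms by (auto simp: has_fourier_transform_def)
  let ?a = "\<lambda>v R \<xi>. LINT x:{-R..R}|lborel. exp (- (\<i> * complex_of_real (x * \<xi>))) * of_real (v x)"
  let ?I = "\<lambda>v w R. \<integral>\<^sup>+ \<xi>. ennreal ((norm (?a v R \<xi> - w \<xi>))\<^sup>2) \<partial>lborel"
  have mw: "w \<in> borel_measurable lborel" "w' \<in> borel_measurable lborel"
    using sq by (auto simp: square_integrable_def)
  have lim: "(?I v w \<longlongrightarrow> 0) at_top" "(?I v' w' \<longlongrightarrow> 0) at_top"
    using assms by (simp_all only: has_fourier_transform_def)
  have 1: "((\<lambda>R. 2 * ?I v w R + 2 * ?I v' w' R) \<longlongrightarrow> 2 * 0 + 2 * 0) at_top"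
    by (intro tendsto_add ennreal_tendsto_cmult lim) auto
  have a: "?a (\<lambda>x. v x - v' x) R \<xi> = ?a v R \<xi> - ?a v' R \<xi>" for R \<xi>
    using set_integral_diff(2)[OF square_integrable_truncated[OF sq(1)] square_integrable_truncated[OF sq(2)], of R \<xi> \<xi>]
    by (simp only: of_real_diff right_diff_distrib)
  have 2: "?I (\<lambda>x. v x - v' x) (\<lambda>\<xi>. w \<xi> - w' \<xi>) R \<le> 2 * ?I v w R + 2 * ?I v' w' R" for R
  proof -
    have d: "(?a v R \<xi> - ?a v' R \<xi>) - (w \<xi> - w' \<xi>) = (?a v R \<xi> - w \<xi>) - (?a v' R \<xi> - w' \<xi>)" for \<xi> by simp
    show ?thesis
      using nn_integral_norm_diff_square_le[OF borel_measurable_diff[OF borel_measurable_truncated[OF sq(1)] mw(1)]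
          borel_measurable_diff[OF borel_measurable_truncated[OF sq(2)] mw(2)], of R R]
      unfolding a d .
  qed
  have "(?I (\<lambda>x. v x - v' x) (\<lambda>\<xi>. w \<xi> - w' \<xi>) \<longlongrightarrow> 0) at_top"
    by (rule tendsto_sandwich[OF _ _ tendsto_const 1[simplified]]) (use 2 in auto)
  then show ?thesis unfolding has_fourier_transform_def by (intro conjI square_integrable_diff sq)
qed

section \<open>Absolute integrability of the weighted transform\<close>

lemma le_sqrt_mult_if_le_weighted:
  fixes I P A :: real
  assumes le: "\<And>c. c > 0 \<Longrightarrow> I \<le> c / 2 * P + 1 / (2 * c) * A" and P: "P \<ge> 0" and A: "A \<ge> 0"
  shows "I \<le> sqrt P * (1 + A)"
proof (cases "P = 0")
  case False
  define r where "r = sqrt P"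
  have r: "r > 0" "P = r\<^sup>2" using False P by (auto simp: r_def)
  \<comment> \<open>The weight \<open>1 / sqrt P\<close> makes both terms proportional to
    \<open>sqrt P\<close>. The sharp \<open>sqrt (P * A)\<close> is given up, since only
    proportionality to the norm matters.\<close>
  have "I \<le> (1 / r) / 2 * P + 1 / (2 * (1 / r)) * A"
    using r by (intro le) auto
  also have "\<dots> = r / 2 + r * A / 2" using r(1) unfolding r(2) by (simp add: power2_eq_square)
  also have "\<dots> \<le> r * (1 + A)" using r(1) A by (simp add: field_simps)
  finally show ?thesis by (simp add: r_def)
next
  case True
  \<comment> \<open>With \<open>P = 0\<close> the weight may be arbitrarily large. For positive
    \<open>I\<close>, the weight \<open>(1 + A) / I\<close> already bounds \<open>I\<close> by less
    than half of itself.\<close>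
  have "I \<le> 0"
  proof (rule ccontr)
    assume I: "\<not> ?thesis"
    then have "I \<le> 1 / (2 * ((1 + A) / I)) * A"
      using le[of "(1 + A) / I"] A True by simp
    also have "\<dots> = I * (A / (2 * (1 + A)))" by simp
    also have "\<dots> < I * 1"
      using A I by (intro mult_strict_left_mono) (auto simp: field_simps)
    finally show False by simp
  qed
  then show ?thesis using True by simp
qed

text \<open>A Cauchy-Schwarz argument: the integrand is the product of
  \<open>(1 + \<xi>\<^sup>2) powr (s / 2) * norm (w \<xi>)\<close>, whose square gives the Sobolev
  norm, and \<open>(1 + \<xi>\<^sup>2) powr ((1 - s) / 2)\<close>, whose square is the integrable
  weight. The factor \<open>sqrt (1 + \<xi>\<^sup>2)\<close> dominates both 1 and the modulus of
  \<open>\<xi>\<close>, so \<open>v\<close> and its derivative are handled together.\<close>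

lemma weighted_L1_bound:
  fixes w :: "real \<Rightarrow> complex"
  assumes s: "s > 3 / 2" and [measurable]: "w \<in> borel_measurable lborel"
    and i: "integrable lborel (\<lambda>\<xi>. (1 + \<xi>\<^sup>2) powr s * (norm (w \<xi>))\<^sup>2)"
  shows "integrable lborel (\<lambda>\<xi>. sqrt (1 + \<xi>\<^sup>2) * norm (w \<xi>))" (is "integrable _ ?f")
    and "(LINT \<xi>|lborel. sqrt (1 + \<xi>\<^sup>2) * norm (w \<xi>)) \<le>
      sqrt (LINT \<xi>|lborel. (1 + \<xi>\<^sup>2) powr s * (norm (w \<xi>))\<^sup>2) * (1 + (LINT \<xi>|lborel. (1 + \<xi>\<^sup>2) powr (1 - s)))"
    (is "_ \<le> sqrt ?P * (1 + ?A)")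
proof -
  have W: "integrable lborel (\<lambda>\<xi>::real. (1 + \<xi>\<^sup>2) powr (1 - s))"
    using integrable_sobolev_weight[OF s] .
  have pt: "?f \<xi> \<le> c / 2 * ((1 + \<xi>\<^sup>2) powr s * (norm (w \<xi>))\<^sup>2) + 1 / (2 * c) * (1 + \<xi>\<^sup>2) powr (1 - s)" if "c > 0" for \<xi> c
  proof -
    define p where "p = (1 + \<xi>\<^sup>2) powr (s / 2) * norm (w \<xi>)"
    define q where "q = (1 + \<xi>\<^sup>2) powr ((1 - s) / 2)"
    have pos: "1 + \<xi>\<^sup>2 > 0" by (rule add_pos_nonneg) auto
    have p2: "p\<^sup>2 = (1 + \<xi>\<^sup>2) powr s * (norm (w \<xi>))\<^sup>2"
      using pos by (simp add: p_def power_mult_distrib powr_power)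
    have "q * q = (1 + \<xi>\<^sup>2) powr (1 - s)" unfolding q_def powr_add[symmetric] by simp
    then have q2: "q\<^sup>2 = (1 + \<xi>\<^sup>2) powr (1 - s)" unfolding power2_eq_square[of q] .
    have "q * p = ((1 + \<xi>\<^sup>2) powr ((1 - s) / 2) * (1 + \<xi>\<^sup>2) powr (s / 2)) * norm (w \<xi>)" by (simp add: p_def q_def)
    also have "\<dots> = ?f \<xi>" using pos unfolding powr_add[symmetric] by (simp add: powr_half_sqrt add_divide_distrib[symmetric])
    finally have pq: "q * p = ?f \<xi>" .
    have "0 \<le> (c * p - q)\<^sup>2 / (2 * c)" using that by simp
    also have "\<dots> = c / 2 * p\<^sup>2 + 1 / (2 * c) * q\<^sup>2 - q * p"
      using that by (simp add: power2_eq_square field_simps)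
    finally show ?thesis unfolding p2 q2 pq by simp
  qed
  have int: "integrable lborel (\<lambda>\<xi>. c / 2 * ((1 + \<xi>\<^sup>2) powr s * (norm (w \<xi>))\<^sup>2) + 1 / (2 * c) * (1 + \<xi>\<^sup>2) powr (1 - s))" for c
    using i W by (intro Bochner_Integration.integrable_add integrable_mult_right)
  show f: "integrable lborel ?f"
  proof (rule Bochner_Integration.integrable_bound[OF int[of 1]])
    show "AE \<xi> in lborel. norm (?f \<xi>) \<le> norm (1 / 2 * ((1 + \<xi>\<^sup>2) powr s * (norm (w \<xi>))\<^sup>2) + 1 / (2 * 1) * (1 + \<xi>\<^sup>2) powr (1 - s))"
      using pt[of 1] by (intro AE_I2) (force intro: order_trans)
  qed measurable
  have le: "integral\<^sup>L lborel ?f \<le> c / 2 * ?P + 1 / (2 * c) * ?A" if "c > 0" for c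
  proof -
    have "integral\<^sup>L lborel ?f \<le> (LINT \<xi>|lborel. c / 2 * ((1 + \<xi>\<^sup>2) powr s * (norm (w \<xi>))\<^sup>2) + 1 / (2 * c) * (1 + \<xi>\<^sup>2) powr (1 - s))"
      using pt[OF that] by (intro integral_mono f int)
    also have "\<dots> = c / 2 * ?P + 1 / (2 * c) * ?A"
      using i W by (subst Bochner_Integration.integral_add) auto
    finally show ?thesis .
  qed
  have A: "?A \<ge> 0" and P: "?P \<ge> 0" by auto
  show "integral\<^sup>L lborel ?f \<le> sqrt ?P * (1 + ?A)"
    by (rule le_sqrt_mult_if_le_weighted[OF le]) auto
qed

section \<open>Differentiating and continuity of the inverse transform\<close>

lemma norm_iexp_diff_le: "norm (iexp x - 1) \<le> \<bar>x\<bar>"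
  using dist_exp_i_1[of x] abs_sin_x_le_abs_x[of "x / 2"] by simp

text \<open>Differentiation under the integral: the difference quotient of the exponential is
  bounded by the modulus of \<open>\<xi>\<close>, so \<open>of_real \<xi> * w \<xi>\<close>
  dominates. Working along sequences makes the dominated convergence theorem applicable.\<close>

lemma inverse_fourier_derivative:
  assumes w: "integrable lborel w" and xw: "integrable lborel (\<lambda>\<xi>. of_real \<xi> * w \<xi>)"
    and rep: "\<And>y. of_real (2 * pi * v y) = (LINT \<xi>|lborel. w \<xi> * iexp (y * \<xi>))"
  shows "(v has_real_derivative Re (LINT \<xi>|lborel. \<i> * (of_real \<xi> * w \<xi>) * iexp (y * \<xi>)) / (2 * pi)) (at y)"
proof -
  have [measurable]: "w \<in> borel_measurable lborel" using w by auto
  let ?D = "LINT \<xi>|lborel. \<i> * (of_real \<xi> * w \<xi>) * iexp (y * \<xi>)"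
  have int: "integrable lborel (\<lambda>\<xi>. w \<xi> * iexp (y * \<xi>))" for y
  proof (rule Bochner_Integration.integrable_bound[OF w])
    show "AE \<xi> in lborel. norm (w \<xi> * iexp (y * \<xi>)) \<le> norm (w \<xi>)"
      unfolding norm_mult norm_exp_i_times by simp
  qed measurable
  have "(\<lambda>n. (v (y + X n) - v y) / X n) \<longlonglongrightarrow> Re ?D / (2 * pi)" if X: "\<And>n. X n \<noteq> 0" "X \<longlonglongrightarrow> 0" for X
  proof -
    define q where "q n \<xi> = w \<xi> * iexp (y * \<xi>) * ((iexp (X n * \<xi>) - 1) / of_real (X n))" for n \<xi>
    have "(\<lambda>n. LINT \<xi>|lborel. q n \<xi>) \<longlonglongrightarrow> ?D"
    proof (rule integral_dominated_convergence[where w="\<lambda>\<xi>. norm (of_real \<xi> * w \<xi>)"])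
      show "integrable lborel (\<lambda>\<xi>. norm (of_real \<xi> * w \<xi>))" using xw by (rule integrable_norm)
      show "AE \<xi> in lborel. norm (q n \<xi>) \<le> norm (of_real \<xi> * w \<xi>)" for n
      proof (rule AE_I2)
        fix \<xi>
        have "norm ((iexp (X n * \<xi>) - 1) / of_real (X n)) \<le> \<bar>X n * \<xi>\<bar> / \<bar>X n\<bar>"
          unfolding norm_divide norm_of_real by (intro divide_right_mono norm_iexp_diff_le) auto
        also have "\<dots> = \<bar>\<xi>\<bar>" using X(1)[of n] by (simp add: abs_mult)
        finally have "norm (w \<xi>) * norm ((iexp (X n * \<xi>) - 1) / of_real (X n)) \<le> norm (w \<xi>) * \<bar>\<xi>\<bar>"
          by (intro mult_left_mono) auto
        then show "norm (q n \<xi>) \<le> norm (of_real \<xi> * w \<xi>)"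
          unfolding q_def norm_mult[of "_ * _"] norm_mult[of "w _"] norm_exp_i_times norm_mult[of "of_real _"] norm_of_real
          by (simp only: mult_1_right mult.commute)
      qed
      show "AE \<xi> in lborel. (\<lambda>n. q n \<xi>) \<longlonglongrightarrow> \<i> * (of_real \<xi> * w \<xi>) * iexp (y * \<xi>)"
      proof (rule AE_I2)
        fix \<xi> :: real
        have "((\<lambda>z. exp (\<i> * of_real \<xi> * z)) has_field_derivative \<i> * of_real \<xi>) (at 0)"
          by (auto intro!: derivative_eq_intros)
        then have "((\<lambda>h. (exp (\<i> * of_real \<xi> * h) - 1) / h) \<longlongrightarrow> \<i> * of_real \<xi>) (at 0)"
          by (simp add: DERIV_def)
        then have "(\<lambda>n. (exp (\<i> * of_real \<xi> * of_real (X n)) - 1) / of_real (X n)) \<longlonglongrightarrow> \<i> * of_real \<xi>"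
        proof (rule filterlim_compose)
          have "(\<lambda>n. complex_of_real (X n)) \<longlonglongrightarrow> 0" using tendsto_of_real[OF X(2)] by simp
          then show "filterlim (\<lambda>n. complex_of_real (X n)) (at 0) sequentially"
            by (rule filterlim_atI) (use X(1) in auto)
        qed
        then have "(\<lambda>n. w \<xi> * iexp (y * \<xi>) * ((exp (\<i> * of_real \<xi> * of_real (X n)) - 1) / of_real (X n))) \<longlonglongrightarrow> w \<xi> * iexp (y * \<xi>) * (\<i> * of_real \<xi>)"
          by (intro tendsto_intros)
        also have "w \<xi> * iexp (y * \<xi>) * (\<i> * of_real \<xi>) = \<i> * (of_real \<xi> * w \<xi>) * iexp (y * \<xi>)"
          by (simp add: mult_ac)
        also have "(\<lambda>n. w \<xi> * iexp (y * \<xi>) * ((exp (\<i> * of_real \<xi> * of_real (X n)) - 1) / of_real (X n))) = (\<lambda>n. q n \<xi>)"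
          by (simp add: q_def mult_ac)
        finally show "(\<lambda>n. q n \<xi>) \<longlonglongrightarrow> \<i> * (of_real \<xi> * w \<xi>) * iexp (y * \<xi>)" .
      qed
    qed (auto simp: q_def)
    then have l: "(\<lambda>n. Re (LINT \<xi>|lborel. q n \<xi>) / (2 * pi)) \<longlonglongrightarrow> Re ?D / (2 * pi)"
      by (intro tendsto_intros) auto
    have "(v (y + X n) - v y) / X n = Re (LINT \<xi>|lborel. q n \<xi>) / (2 * pi)" for n
    proof -
      have "of_real ((2 * pi) * ((v (y + X n) - v y) / X n)) = 
          (complex_of_real (2 * pi * v (y + X n)) - of_real (2 * pi * v y)) / of_real (X n)"
        by (simp add: algebra_simps diff_divide_distrib)
      also have "\<dots> = (LINT \<xi>|lborel. (w \<xi> * iexp ((y + X n) * \<xi>) - w \<xi> * iexp (y * \<xi>)) / of_real (X n))"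
        unfolding rep integral_divide_zero Bochner_Integration.integral_diff[OF int int] ..
      also have "(\<lambda>\<xi>. (w \<xi> * iexp ((y + X n) * \<xi>) - w \<xi> * iexp (y * \<xi>)) / of_real (X n)) = q n"
        by (rule ext) (simp add: q_def distrib_right distrib_left exp_add right_diff_distrib diff_divide_distrib mult.assoc)
      finally have "Re (of_real ((2 * pi) * ((v (y + X n) - v y) / X n))) = Re (LINT \<xi>|lborel. q n \<xi>)" by simp
      then show ?thesis unfolding Re_complex_of_real by (simp add: field_simps)
    qed
    then show ?thesis using l by simp
  qed
  then show ?thesis
    unfolding DERIV_def tendsto_at_iff_sequentially by (auto simp: o_def)
qed

lemma continuous_inverse_fourier:
  fixes w :: "real \<Rightarrow> complex"
  assumes w: "integrable lborel w"
  shows "continuous_on UNIV (\<lambda>y. LINT \<xi>|lborel. w \<xi> * iexp (y * \<xi>))"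
  unfolding continuous_on_sequentially o_def
proof (intro ballI allI impI)
  have [measurable]: "w \<in> borel_measurable lborel" using w by auto
  fix X :: "nat \<Rightarrow> real" and y assume X: "(\<forall>n. X n \<in> UNIV) \<and> X \<longlonglongrightarrow> y"
  show "(\<lambda>n. LINT \<xi>|lborel. w \<xi> * iexp (X n * \<xi>)) \<longlonglongrightarrow> (LINT \<xi>|lborel. w \<xi> * iexp (y * \<xi>))"
  proof (rule integral_dominated_convergence[where w="\<lambda>\<xi>. norm (w \<xi>)"])
    show "integrable lborel (\<lambda>\<xi>. norm (w \<xi>))" using w by simp
    show "AE \<xi> in lborel. norm (w \<xi> * iexp (X n * \<xi>)) \<le> norm (w \<xi>)" for n
      unfolding norm_mult norm_exp_i_times by simp
    show "AE \<xi> in lborel. (\<lambda>n. w \<xi> * iexp (X n * \<xi>)) \<longlonglongrightarrow> w \<xi> * iexp (y * \<xi>)"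
      using X by (intro AE_I2 tendsto_intros) auto
  qed auto
qed

section \<open>Decay at infinity\<close>

lemma square_integrable_tail:
  fixes v :: "real \<Rightarrow> real"
  assumes v: "square_integrable v" and e: "e > 0"
  obtains R where "(LINT x|lborel. indicator {x. R \<le> \<bar>x\<bar>} x * (v x)\<^sup>2) < e"
proof -
  have [measurable]: "v \<in> borel_measurable lborel" and v2: "integrable lborel (\<lambda>x. (v x)\<^sup>2)"
    using v by (auto simp: square_integrable_def)
  have "((\<lambda>R. LINT x|lborel. indicator {x. R \<le> \<bar>x\<bar>} x * (v x)\<^sup>2) \<longlongrightarrow> (LINT (x::real)|lborel. 0)) at_top"
  proof (rule integral_dominated_convergence_at_top[where w="\<lambda>x. (v x)\<^sup>2"])
    show "AE x in lborel. ((\<lambda>R. indicator {x. R \<le> \<bar>x\<bar>} x * (v x)\<^sup>2) \<longlongrightarrow> 0) at_top"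
    proof (rule AE_I2, rule tendsto_eventually)
      fix x :: real
      show "\<forall>\<^sub>F R in at_top. indicator {x. R \<le> \<bar>x\<bar>} x * (v x)\<^sup>2 = 0"
        using eventually_gt_at_top[of "\<bar>x\<bar>"] by eventually_elim auto
    qed
  qed (auto simp: v2 indicator_def)
  then have "\<forall>\<^sub>F R in at_top. (LINT x|lborel. indicator {x. R \<le> \<bar>x\<bar>} x * (v x)\<^sup>2) < e"
    by (rule order_tendstoD(2)) (use e in auto)
  then show ?thesis using that by (auto simp: eventually_at_top_linorder)
qed

text \<open>A large value of \<open>\<bar>v\<bar>\<close> persists on an interval whose length is controlled by the Lipschitz
  constant, so it cannot occur where the tail of the integral of \<open>v\<^sup>2\<close> is small.\<close>

lemma square_integrable_lipschitz_decay:
  fixes v :: "real \<Rightarrow> real"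
  assumes v: "square_integrable v" and lip: "\<And>x y. \<bar>v x - v y\<bar> \<le> B * \<bar>x - y\<bar>" and e: "e > 0"
  obtains R where "\<And>x. R \<le> \<bar>x\<bar> \<Longrightarrow> \<bar>v x\<bar> < e"
proof -
  have [measurable]: "v \<in> borel_measurable lborel" and v2: "integrable lborel (\<lambda>x. (v x)\<^sup>2)"
    using v by (auto simp: square_integrable_def)
  \<comment> \<open>The distance over which \<open>v\<close> changes by at most
    \<open>e / 2\<close>; \<open>\<bar>B\<bar> + 1\<close> keeps the denominator positive for every
    \<open>B\<close>.\<close>
  define \<rho> where "\<rho> = e / (2 * (\<bar>B\<bar> + 1))"
  have \<rho>: "\<rho> > 0" using e by (simp add: \<rho>_def)
  have B\<rho>: "B * r \<le> e / 2" if "0 \<le> r" "r \<le> \<rho>" for r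
  proof -
    have "B * r \<le> (\<bar>B\<bar> + 1) * \<rho>" using that by (intro mult_mono) auto
    also have "\<dots> = e / 2" using abs_ge_zero[of B] unfolding \<rho>_def by (simp add: divide_simps del: abs_ge_zero)
    finally show ?thesis .
  qed
  \<comment> \<open>The threshold is the integral of \<open>(e / 2)\<^sup>2\<close> over an interval
    of length \<open>2 * \<rho>\<close>. The radius is later enlarged by \<open>\<rho>\<close>, so
    that the whole interval around \<open>x\<close> lies in the tail.\<close>
  obtain R where R: "(LINT x|lborel. indicator {x. R \<le> \<bar>x\<bar>} x * (v x)\<^sup>2) < 2 * \<rho> * (e / 2)\<^sup>2"
    by (rule square_integrable_tail[OF v, of "2 * \<rho> * (e / 2)\<^sup>2"]) (use \<rho> e in auto)
  show ?thesis
  proof (rule that[of "R + \<rho>"], rule ccontr)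
    fix x assume x: "R + \<rho> \<le> \<bar>x\<bar>" and "\<not> \<bar>v x\<bar> < e"
    then have vx: "\<bar>v x\<bar> \<ge> e" by simp
    have "2 * \<rho> * (e / 2)\<^sup>2 = (LINT y|lborel. (e / 2)\<^sup>2 * indicator {x - \<rho>..x + \<rho>} y)"
      using \<rho> by simp
    also have "\<dots> \<le> (LINT y|lborel. indicator {x. R \<le> \<bar>x\<bar>} y * (v y)\<^sup>2)"
    proof (rule integral_mono)
      show "integrable lborel (\<lambda>y. (e / 2)\<^sup>2 * indicator {x - \<rho>..x + \<rho>} y)"
        by (intro integrable_mult_right integrable_real_indicator) (auto simp: emeasure_lborel_Icc_eq)
      show "integrable lborel (\<lambda>y. indicator {x. R \<le> \<bar>x\<bar>} y * (v y)\<^sup>2)"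
        by (rule Bochner_Integration.integrable_bound[OF v2]) (auto simp: indicator_def)
      fix y
      show "(e / 2)\<^sup>2 * indicator {x - \<rho>..x + \<rho>} y \<le> indicator {x. R \<le> \<bar>x\<bar>} y * (v y)\<^sup>2"
      proof (cases "y \<in> {x - \<rho>..x + \<rho>}")
        case True
        then have d: "\<bar>x - y\<bar> \<le> \<rho>" by auto
        then have "\<bar>v x - v y\<bar> \<le> e / 2" using lip[of x y] B\<rho>[of "\<bar>x - y\<bar>"] by linarith
        then have "e / 2 \<le> \<bar>v y\<bar>" using vx by linarith
        then have "(e / 2)\<^sup>2 \<le> (v y)\<^sup>2" using e by (subst power2_abs[of "v y", symmetric]) (intro power_mono, auto)
        moreover have "R \<le> \<bar>y\<bar>" using d x by linarith
        ultimately show ?thesis using True by simp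
      qed auto
    qed
    finally show False using R by simp
  qed
qed

text \<open>The factor from \<open>weighted_L1_bound\<close> over the \<open>2 * pi\<close> of the
  inversion formula; it does not depend on the function embedded.\<close>

definition sobolev_embedding_const :: "real \<Rightarrow> real" where
  "sobolev_embedding_const s = (1 + (LINT \<xi>|lborel. (1 + \<xi>\<^sup>2) powr (1 - s))) / (2 * pi)"

text \<open>Membership and norm each refer to some transform, possibly different ones. They agree
  almost everywhere, so integrability passes to the one chosen by \<open>SOME\<close>.\<close>

lemma sobolev_spaceE:
  assumes "v \<in> sobolev_space s"
  obtains w where "has_fourier_transform v w"
    and "integrable lborel (\<lambda>\<xi>. (1 + \<xi>\<^sup>2) powr s * (norm (w \<xi>))\<^sup>2)"
    and "sobolev_norm s v = sqrt (LINT \<xi>|lborel. (1 + \<xi>\<^sup>2) powr s * (norm (w \<xi>))\<^sup>2)"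
proof -
  obtain w' where w': "has_fourier_transform v w'"
    "integrable lborel (\<lambda>\<xi>. (1 + \<xi>\<^sup>2) powr s * (norm (w' \<xi>))\<^sup>2)"
    using assms by (auto simp: sobolev_space_def)
  define w where "w = (SOME w. has_fourier_transform v w)"
  have w: "has_fourier_transform v w" unfolding w_def by (rule someI[of "has_fourier_transform v", OF w'(1)])
  have [measurable]: "w \<in> borel_measurable lborel"
    using w by (simp add: has_fourier_transform_def square_integrable_def)
  have "integrable lborel (\<lambda>\<xi>. (1 + \<xi>\<^sup>2) powr s * (norm (w \<xi>))\<^sup>2)"
  proof (rule Bochner_Integration.integrable_bound[OF w'(2)])
    show "AE \<xi> in lborel. norm ((1 + \<xi>\<^sup>2) powr s * (norm (w \<xi>))\<^sup>2) \<le> norm ((1 + \<xi>\<^sup>2) powr s * (norm (w' \<xi>))\<^sup>2)"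
      using has_fourier_transform_unique[OF w w'(1)] by eventually_elim simp
  qed measurable
  with w show ?thesis by (rule that) (simp add: sobolev_norm_def w_def)
qed

lemma sobolev_space_diff:
  assumes "v \<in> sobolev_space s" "v' \<in> sobolev_space s"
  shows "(\<lambda>x. v x - v' x) \<in> sobolev_space s"
proof -
  obtain w where w: "has_fourier_transform v w"
    "integrable lborel (\<lambda>\<xi>. (1 + \<xi>\<^sup>2) powr s * (norm (w \<xi>))\<^sup>2)"
    using assms(1) by (auto simp: sobolev_space_def)
  obtain w' where w': "has_fourier_transform v' w'"
    "integrable lborel (\<lambda>\<xi>. (1 + \<xi>\<^sup>2) powr s * (norm (w' \<xi>))\<^sup>2)"
    using assms(2) by (auto simp: sobolev_space_def)
  have [measurable]: "w \<in> borel_measurable lborel" "w' \<in> borel_measurable lborel"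
    using w w' by (simp_all add: has_fourier_transform_def square_integrable_def)
  have "integrable lborel (\<lambda>\<xi>. (1 + \<xi>\<^sup>2) powr s * (norm (w \<xi> - w' \<xi>))\<^sup>2)"
  proof (rule Bochner_Integration.integrable_bound)
    show "integrable lborel (\<lambda>\<xi>. 2 * ((1 + \<xi>\<^sup>2) powr s * (norm (w \<xi>))\<^sup>2) + 2 * ((1 + \<xi>\<^sup>2) powr s * (norm (w' \<xi>))\<^sup>2))"
      using w w' by simp
    have "(1 + \<xi>\<^sup>2) powr s * (norm (w \<xi> - w' \<xi>))\<^sup>2 \<le>
        2 * ((1 + \<xi>\<^sup>2) powr s * (norm (w \<xi>))\<^sup>2) + 2 * ((1 + \<xi>\<^sup>2) powr s * (norm (w' \<xi>))\<^sup>2)" for \<xi>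
    proof -
      have "(1 + \<xi>\<^sup>2) powr s * (norm (w \<xi> - w' \<xi>))\<^sup>2 \<le>
          (1 + \<xi>\<^sup>2) powr s * (2 * (norm (w \<xi>))\<^sup>2 + 2 * (norm (w' \<xi>))\<^sup>2)"
        by (intro mult_left_mono norm_diff_square_le) auto
      then show ?thesis by (simp add: algebra_simps)
    qed
    then show "AE \<xi> in lborel. norm ((1 + \<xi>\<^sup>2) powr s * (norm (w \<xi> - w' \<xi>))\<^sup>2) \<le>
        norm (2 * ((1 + \<xi>\<^sup>2) powr s * (norm (w \<xi>))\<^sup>2) + 2 * ((1 + \<xi>\<^sup>2) powr s * (norm (w' \<xi>))\<^sup>2))"
      by (intro AE_I2) (auto intro: order_trans)
  qed measurable
  then show ?thesis using has_fourier_transform_diff[OF w(1) w'(1)] by (auto simp: sobolev_space_def)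
qed

text \<open>Since \<open>w\<close> and \<open>\<xi>\<close> times \<open>w\<close> are both
  integrable, inversion holds pointwise and may be differentiated; the two sup bounds are then the
  same weighted integral bound. Continuity is assumed because elements of
  \<open>sobolev_space\<close> are functions, and it singles out the right representative.\<close>

lemma sobolev_embedding:
  assumes s: "s > 3 / 2" and v: "v \<in> sobolev_space s" and cont: "continuous_on UNIV v"
  shows "(v has_real_derivative deriv v y) (at y)"
    and "continuous_on UNIV (deriv v)"
    and "\<bar>v y\<bar> \<le> sobolev_embedding_const s * sobolev_norm s v"
    and "\<bar>deriv v y\<bar> \<le> sobolev_embedding_const s * sobolev_norm s v"
    and "e > 0 \<Longrightarrow> \<exists>R. \<forall>x. R \<le> \<bar>x\<bar> \<longrightarrow> \<bar>v x\<bar> < e"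
proof -
  obtain w where w: "has_fourier_transform v w"
    "integrable lborel (\<lambda>\<xi>. (1 + \<xi>\<^sup>2) powr s * (norm (w \<xi>))\<^sup>2)"
    and nrm: "sobolev_norm s v = sqrt (LINT \<xi>|lborel. (1 + \<xi>\<^sup>2) powr s * (norm (w \<xi>))\<^sup>2)"
    using sobolev_spaceE[OF v] .
  have [measurable]: "w \<in> borel_measurable lborel"
    using w by (simp add: has_fourier_transform_def square_integrable_def)
  note L1 = weighted_L1_bound[OF s _ w(2), simplified]
  have le: "norm (w \<xi>) \<le> sqrt (1 + \<xi>\<^sup>2) * norm (w \<xi>)" "\<bar>\<xi>\<bar> * norm (w \<xi>) \<le> sqrt (1 + \<xi>\<^sup>2) * norm (w \<xi>)" for \<xi>
  proof -
    have "1 \<le> sqrt (1 + \<xi>\<^sup>2)" "\<bar>\<xi>\<bar> \<le> sqrt (1 + \<xi>\<^sup>2)"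
      by (auto intro: real_le_rsqrt)
    then show "norm (w \<xi>) \<le> sqrt (1 + \<xi>\<^sup>2) * norm (w \<xi>)" "\<bar>\<xi>\<bar> * norm (w \<xi>) \<le> sqrt (1 + \<xi>\<^sup>2) * norm (w \<xi>)"
      using mult_right_mono[of 1 "sqrt (1 + \<xi>\<^sup>2)" "norm (w \<xi>)"] by (auto intro!: mult_right_mono)
  qed
  have i0: "integrable lborel w"
    by (rule Bochner_Integration.integrable_bound[OF L1(1)]) (use le(1) in \<open>auto simp: abs_mult\<close>)
  have i1: "integrable lborel (\<lambda>\<xi>. of_real \<xi> * w \<xi>)"
    by (rule Bochner_Integration.integrable_bound[OF L1(1)]) (use le(2) in \<open>auto simp: abs_mult norm_mult\<close>)
  have i1': "integrable lborel (\<lambda>\<xi>. \<i> * (of_real \<xi> * w \<xi>))"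
    using i1 by (rule integrable_mult_right)
  have rep: "of_real (2 * pi * v y) = (LINT \<xi>|lborel. w \<xi> * iexp (y * \<xi>))" for y
    by (rule fourier_inversion[OF w(1) i0 cont])
  let ?D = "\<lambda>y. LINT \<xi>|lborel. \<i> * (of_real \<xi> * w \<xi>) * iexp (y * \<xi>)"
  have D: "(v has_real_derivative Re (?D y) / (2 * pi)) (at y)" for y
    by (rule inverse_fourier_derivative[OF i0 i1 rep])
  then have deriv_eq: "deriv v = (\<lambda>y. Re (?D y) / (2 * pi))"
    by (intro ext DERIV_imp_deriv)
  show der: "(v has_real_derivative deriv v y) (at y)" for y
    using D unfolding deriv_eq .
  show "continuous_on UNIV (deriv v)"
    unfolding deriv_eq by (intro continuous_intros continuous_inverse_fourier i1') auto
  have bound: "norm (LINT \<xi>|lborel. f \<xi> * iexp (y * \<xi>)) / (2 * pi) \<le> sobolev_embedding_const s * sobolev_norm s v"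
    if f: "integrable lborel f" "\<And>\<xi>. norm (f \<xi>) \<le> sqrt (1 + \<xi>\<^sup>2) * norm (w \<xi>)" for f y
  proof -
    have "norm (LINT \<xi>|lborel. f \<xi> * iexp (y * \<xi>)) \<le> (LINT \<xi>|lborel. norm (f \<xi> * iexp (y * \<xi>)))"
      by (rule integral_norm_bound)
    also have "\<dots> = (LINT \<xi>|lborel. norm (f \<xi>))" unfolding norm_mult norm_exp_i_times by simp
    also have "\<dots> \<le> (LINT \<xi>|lborel. sqrt (1 + \<xi>\<^sup>2) * norm (w \<xi>))"
      by (rule integral_mono[OF integrable_norm[OF f(1)] L1(1) f(2)])
    also have "\<dots> \<le> sobolev_norm s v * (1 + (LINT \<xi>|lborel. (1 + \<xi>\<^sup>2) powr (1 - s)))"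
      unfolding nrm by (rule L1(2))
    finally have "norm (LINT \<xi>|lborel. f \<xi> * iexp (y * \<xi>)) / (2 * pi) \<le>
        sobolev_norm s v * (1 + (LINT \<xi>|lborel. (1 + \<xi>\<^sup>2) powr (1 - s))) / (2 * pi)"
      by (intro divide_right_mono) auto
    then show ?thesis by (simp add: sobolev_embedding_const_def mult.commute)
  qed
  show "\<bar>v y\<bar> \<le> sobolev_embedding_const s * sobolev_norm s v"
  proof -
    have a: "norm (complex_of_real (2 * pi * v y)) = 2 * pi * \<bar>v y\<bar>" unfolding norm_of_real by (simp add: abs_mult)
    have "\<bar>v y\<bar> = norm (complex_of_real (2 * pi * v y)) / (2 * pi)" unfolding a by simp
    then show ?thesis unfolding rep using bound[OF i0 le(1)] by simp
  qed
  show d: "\<bar>deriv v y\<bar> \<le> sobolev_embedding_const s * sobolev_norm s v" for y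
  proof -
    have "\<bar>deriv v y\<bar> \<le> norm (?D y) / (2 * pi)"
      unfolding deriv_eq abs_divide by (simp add: abs_Re_le_cmod divide_right_mono)
    also have "\<dots> \<le> sobolev_embedding_const s * sobolev_norm s v"
      by (rule bound[OF i1']) (use le(2) in \<open>simp add: norm_mult\<close>)
    finally show ?thesis .
  qed
  \<comment> \<open>The bound on the derivative serves as the Lipschitz constant in the decay
    argument.\<close>
  have "\<bar>v x - v y\<bar> \<le> sobolev_embedding_const s * sobolev_norm s v * \<bar>x - y\<bar>" for x y
    using field_differentiable_bound[of UNIV v "deriv v" "sobolev_embedding_const s * sobolev_norm s v" x y] der d
    by simp
  then show "\<exists>R. \<forall>x. R \<le> \<bar>x\<bar> \<longrightarrow> \<bar>v x\<bar> < e" if "e > 0"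
    using square_integrable_lipschitz_decay[of v _ e] w(1) that unfolding has_fourier_transform_def by metis
qed

lemma sobolev_embedding_const_nonneg: "0 \<le> sobolev_embedding_const s"
  unfolding sobolev_embedding_const_def by (intro divide_nonneg_nonneg add_nonneg_nonneg Bochner_Integration.integral_nonneg) auto

lemma continuous_into_sobolev_uniform:
  assumes u: "continuous_into_sobolev T s u" and s: "s > 3 / 2"
    and cont: "\<And>t. t \<in> {0..T} \<Longrightarrow> continuous_on UNIV (u t)"
    and t: "t \<in> {0..T}" and e: "e > 0"
  shows "\<exists>d>0. \<forall>\<tau>\<in>{0..T}. \<bar>\<tau> - t\<bar> < d \<longrightarrow>
    (\<forall>x. \<bar>u \<tau> x - u t x\<bar> < e \<and> \<bar>deriv (u \<tau>) x - deriv (u t) x\<bar> < e)"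
proof -
  define C where "C = sobolev_embedding_const s"
  have C: "C \<ge> 0" unfolding C_def by (rule sobolev_embedding_const_nonneg)
  have mem: "u \<tau> \<in> sobolev_space s" if "\<tau> \<in> {0..T}" for \<tau>
    using u that by (auto simp: continuous_into_sobolev_def)
  have "((\<lambda>\<tau>. sobolev_norm s (\<lambda>x. u \<tau> x - u t x)) \<longlongrightarrow> 0) (at t within {0..T})"
    using u t by (auto simp: continuous_into_sobolev_def)
  then have "\<forall>\<^sub>F \<tau> in at t within {0..T}. sobolev_norm s (\<lambda>x. u \<tau> x - u t x) < e / (C + 1)"
    by (rule order_tendstoD(2)) (use C e in \<open>auto intro: divide_pos_pos\<close>)
  then obtain d where d: "d > 0" "\<And>\<tau>. \<tau> \<in> {0..T} \<Longrightarrow> \<tau> \<noteq> t \<Longrightarrow> \<bar>\<tau> - t\<bar> < d \<Longrightarrow>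
      sobolev_norm s (\<lambda>x. u \<tau> x - u t x) < e / (C + 1)"
    unfolding eventually_at dist_real_def by blast
  have "\<bar>u \<tau> x - u t x\<bar> < e \<and> \<bar>deriv (u \<tau>) x - deriv (u t) x\<bar> < e"
    if \<tau>: "\<tau> \<in> {0..T}" "\<bar>\<tau> - t\<bar> < d" for \<tau> x
  \<comment> \<open>The limit in time says nothing about \<open>\<tau> = t\<close> itself, where the
    difference is zero.\<close>
  proof (cases "\<tau> = t")
    case False
    let ?v = "\<lambda>x. u \<tau> x - u t x"
    note emb = sobolev_embedding[OF s sobolev_space_diff[OF mem[OF \<tau>(1)] mem[OF t]]
        continuous_on_diff[OF cont[OF \<tau>(1)] cont[OF t]]]
    have "C * sobolev_norm s ?v \<le> C * (e / (C + 1))"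
      using d(2)[OF \<tau>(1) False \<tau>(2)] C by (intro mult_left_mono) auto
    also have "\<dots> < e" using C e by (simp add: divide_simps)
    finally have small: "C * sobolev_norm s ?v < e" .
    have "(?v has_real_derivative deriv (u \<tau>) x - deriv (u t) x) (at x)"
      by (intro DERIV_diff sobolev_embedding(1)[OF s mem cont] \<tau> t)
    then have "deriv ?v x = deriv (u \<tau>) x - deriv (u t) x" by (rule DERIV_imp_deriv)
    with emb(3,4)[of x] small show ?thesis unfolding C_def by linarith
  qed (use e in auto)
  with d(1) show ?thesis by blast
qed

subsection \<open>The inverse Helmholtz operator\<close>

lemma exp_tail_integrals:
  "integrable lborel (\<lambda>y. indicator {x..} y *\<^sub>R exp (- y) :: real)"
  "(LINT y:{x..}|lborel. exp (- y)) = (exp (- x) :: real)"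
  "integrable lborel (\<lambda>y. indicator {..x} y *\<^sub>R exp y :: real)"
  "(LINT y:{..x}|lborel. exp y) = (exp x :: real)"
proof -
  have right: "has_bochner_integral lborel (\<lambda>y. indicator {x..} y *\<^sub>R exp (- y)) (exp (- x))" for x :: real
  proof (rule has_bochner_integral_nn_integral)
    have "(\<integral>\<^sup>+ y. ennreal (exp (- y)) * indicator {x..} y \<partial>lborel) = ennreal (0 - (- exp (- x)))"
    proof (rule nn_integral_FTC_atLeast)
      show "((\<lambda>y::real. - exp (- y)) has_real_derivative exp (- y)) (at y)" for y
        by (auto intro!: derivative_eq_intros)
      have "((\<lambda>y::real. exp (- y)) \<longlongrightarrow> 0) at_top"
        by (rule filterlim_compose[OF exp_at_bot filterlim_uminus_at_bot_at_top])
      then show "((\<lambda>y::real. - exp (- y)) \<longlongrightarrow> 0) at_top" using tendsto_minus by force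
    qed auto
    then show "(\<integral>\<^sup>+ y. ennreal (indicator {x..} y *\<^sub>R exp (- y)) \<partial>lborel) = ennreal (exp (- x))"
      by (simp add: ennreal_mult' ennreal_indicator mult.commute)
  qed auto
  have "has_bochner_integral lborel (\<lambda>y. indicator {-x..} (0 + (-1) * y) *\<^sub>R exp (- (0 + (-1) * y))) (exp (- (- x)) /\<^sub>R \<bar>-1\<bar>)"
    using right[of "-x"] by (subst lborel_has_bochner_integral_real_affine_iff[symmetric]) auto
  also have "(\<lambda>y. indicator {-x..} (0 + (-1) * y) *\<^sub>R exp (- (0 + (-1) * y))) = (\<lambda>y. indicator {..x} y *\<^sub>R exp y)"
    by (auto simp: indicator_def)
  finally have left: "has_bochner_integral lborel (\<lambda>y. indicator {..x} y *\<^sub>R exp y) (exp x)" by simp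
  show "integrable lborel (\<lambda>y. indicator {x..} y *\<^sub>R exp (- y) :: real)"
    "(LINT y:{x..}|lborel. exp (- y)) = (exp (- x) :: real)"
    "integrable lborel (\<lambda>y. indicator {..x} y *\<^sub>R exp y :: real)"
    "(LINT y:{..x}|lborel. exp y) = (exp x :: real)"
    using right[of x] left by (simp_all only: has_bochner_integral_iff set_lebesgue_integral_def)
qed

text \<open>The fundamental theorem is available on compact intervals, so the fixed tail up to
  \<open>x - 1\<close> is split off. The point \<open>x\<close> is interior to
  \<open>{x - 1..x + 1}\<close>, which removes the restriction on the derivative.\<close>

lemma set_integral_atMost_has_derivative:
  fixes \<phi> :: "real \<Rightarrow> real"
  assumes int: "\<And>c. set_integrable lborel {..c} \<phi>" and cont: "continuous_on UNIV \<phi>"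
  shows "((\<lambda>x. LINT y:{..x}|lborel. \<phi> y) has_real_derivative \<phi> x) (at x)"
proof -
  have eq: "(LINT y:{..z}|lborel. \<phi> y) = (LINT y:{..x - 1}|lborel. \<phi> y) + integral {x - 1..z} \<phi>"
    if "z \<in> {x - 1..x + 1}" for z
  proof -
    have i: "set_integrable lborel {x - 1..z} \<phi>" 
      by (rule set_integrable_subset[OF int[of z]]) auto
    have "{..z} = {..x - 1} \<union> {x - 1<..z}" using that by auto
    then have "(LINT y:{..z}|lborel. \<phi> y) = (LINT y:{..x - 1}|lborel. \<phi> y) + (LINT y:{x - 1<..z}|lborel. \<phi> y)"
      by (simp add: set_integral_Un int set_integrable_subset[OF int[of z]] disjoint_iff subset_iff)
    also have "(LINT y:{x - 1<..z}|lborel. \<phi> y) = (LINT y:{x - 1..z}|lborel. \<phi> y)"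
      unfolding set_lebesgue_integral_def
    proof (rule Bochner_Integration.integral_cong_AE)
      show "AE y in lborel. indicator {x - 1<..z} y *\<^sub>R \<phi> y = indicator {x - 1..z} y *\<^sub>R \<phi> y"
        using AE_lborel_singleton[of "x - 1"] by eventually_elim (auto simp: indicator_def)
      have [measurable]: "\<phi> \<in> borel_measurable borel" using cont by (rule borel_measurable_continuous_onI)
      show "(\<lambda>y. indicator {x - 1<..z} y *\<^sub>R \<phi> y) \<in> borel_measurable lborel"
        "(\<lambda>y. indicator {x - 1..z} y *\<^sub>R \<phi> y) \<in> borel_measurable lborel" by measurable
    qed
    also have "\<dots> = integral {x - 1..z} \<phi>" by (rule set_borel_integral_eq_integral(2)[OF i])
    finally show ?thesis .
  qed
  have "((\<lambda>z. integral {x - 1..z} \<phi>) has_real_derivative \<phi> x) (at x within {x - 1..x + 1})"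
    by (rule integral_has_real_derivative) (auto intro: continuous_on_subset[OF cont])
  then have "((\<lambda>z. (LINT y:{..x - 1}|lborel. \<phi> y) + integral {x - 1..z} \<phi>) has_real_derivative \<phi> x) (at x within {x - 1..x + 1})"
    by (auto intro!: derivative_eq_intros)
  then have "((\<lambda>z. LINT y:{..z}|lborel. \<phi> y) has_real_derivative \<phi> x) (at x within {x - 1..x + 1})"
    by (rule has_field_derivative_transform_within[where d=1]) (auto intro: eq[symmetric])
  moreover have "at x within {x - 1..x + 1} = at x" by (rule at_within_Icc_at) auto
  ultimately show ?thesis by (simp only:)
qed

lemma set_integral_atLeast_has_derivative:
  fixes \<phi> :: "real \<Rightarrow> real"
  assumes int: "\<And>c. set_integrable lborel {c..} \<phi>" and cont: "continuous_on UNIV \<phi>"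
  shows "((\<lambda>x. LINT y:{x..}|lborel. \<phi> y) has_real_derivative - \<phi> x) (at x)"
proof -
  have mirror: "indicator {- c..} (0 + (-1) * y) *\<^sub>R \<phi> (0 + (-1) * y) = indicator {..c} y *\<^sub>R \<phi> (- y)" for c y :: real
    by (auto simp: indicator_def)
  have int': "set_integrable lborel {..c} (\<lambda>y. \<phi> (- y))" for c
    using lborel_integrable_real_affine[OF int[of "-c", unfolded set_integrable_def], of "-1" 0]
    unfolding mirror set_integrable_def by simp
  have eq: "(LINT y:{c..}|lborel. \<phi> y) = (LINT y:{..-c}|lborel. \<phi> (- y))" for c
  proof -
    have "(LINT y:{c..}|lborel. \<phi> y) = \<bar>-1\<bar> *\<^sub>R (LINT y|lborel. indicator {- (- c)..} (0 + (-1) * y) *\<^sub>R \<phi> (0 + (-1) * y))"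
      unfolding set_lebesgue_integral_def minus_minus by (rule lborel_integral_real_affine) simp
    then show ?thesis unfolding mirror set_lebesgue_integral_def by simp
  qed
  have "((\<lambda>c. LINT y:{..c}|lborel. \<phi> (- y)) has_real_derivative \<phi> (- (- x))) (at (- x))"
    by (rule set_integral_atMost_has_derivative[OF int']) (auto intro!: continuous_on_compose2[OF cont] continuous_intros)
  then have "((\<lambda>x. LINT y:{..-x}|lborel. \<phi> (- y)) has_real_derivative \<phi> (- (- x)) * (- 1)) (at x)"
    by (rule DERIV_chain2) (auto intro!: derivative_eq_intros)
  then show ?thesis unfolding eq by simp
qed

text \<open>Splitting the kernel at \<open>y = x\<close> separates the variables, as
  \<open>exp (- (x - y))\<close> is \<open>exp (- x) * exp y\<close>. Each half can then be
  differentiated in \<open>x\<close> despite the kink of the kernel.\<close>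

definition exp_left_mass :: "(real \<Rightarrow> real) \<Rightarrow> real \<Rightarrow> real" where
  "exp_left_mass h x = (LINT y:{..x}|lborel. exp y * h y)"

definition exp_right_mass :: "(real \<Rightarrow> real) \<Rightarrow> real \<Rightarrow> real" where
  "exp_right_mass h x = (LINT y:{x..}|lborel. exp (- y) * h y)"

text \<open>The convolution of \<open>helmholtz_kernel\<close> with \<open>h\<close>, in one-sided
  form.\<close>

definition inv_helmholtz :: "(real \<Rightarrow> real) \<Rightarrow> real \<Rightarrow> real" where
  "inv_helmholtz h x = (exp x * exp_right_mass h x + exp (- x) * exp_left_mass h x) / 2"

context
  fixes h :: "real \<Rightarrow> real" and H :: real
  assumes cont: "continuous_on UNIV h" and h_nonneg: "\<And>x. 0 \<le> h x" and h_le: "\<And>x. h x \<le> H"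
begin

lemma h_borel [measurable]: "h \<in> borel_measurable borel"
  using cont by (rule borel_measurable_continuous_onI)

lemma integrable_exp_left: "set_integrable lborel {..x} (\<lambda>y. exp y * h y)"
  unfolding set_integrable_def
proof (rule Bochner_Integration.integrable_bound)
  show "integrable lborel (\<lambda>y. H * (indicator {..x} y *\<^sub>R exp y))"
    by (rule integrable_mult_right[OF exp_tail_integrals(3)])
  show "AE y in lborel. norm (indicator {..x} y *\<^sub>R (exp y * h y)) \<le> norm (H * (indicator {..x} y *\<^sub>R exp y))"
    using h_nonneg order_trans[OF h_nonneg h_le] h_le by (auto simp: indicator_def abs_mult intro!: mult_right_mono)
qed measurable

lemma integrable_exp_right: "set_integrable lborel {x..} (\<lambda>y. exp (- y) * h y)"
  unfolding set_integrable_def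
proof (rule Bochner_Integration.integrable_bound)
  show "integrable lborel (\<lambda>y. H * (indicator {x..} y *\<^sub>R exp (- y)))"
    by (rule integrable_mult_right[OF exp_tail_integrals(1)])
  show "AE y in lborel. norm (indicator {x..} y *\<^sub>R (exp (- y) * h y)) \<le> norm (H * (indicator {x..} y *\<^sub>R exp (- y)))"
    using h_nonneg order_trans[OF h_nonneg h_le] h_le by (auto simp: indicator_def abs_mult intro!: mult_right_mono)
qed measurable

lemma exp_left_mass_bounds: "0 \<le> exp_left_mass h x" "exp_left_mass h x \<le> H * exp x"
proof -
  show "0 \<le> exp_left_mass h x"
    unfolding exp_left_mass_def set_lebesgue_integral_def using h_nonneg by (intro Bochner_Integration.integral_nonneg) auto
  have "exp_left_mass h x \<le> (LINT y:{..x}|lborel. H * exp y)"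
    unfolding exp_left_mass_def
    by (rule set_integral_mono[OF integrable_exp_left])
      (use exp_tail_integrals(3)[of x] h_le in \<open>auto simp: set_integrable_def mult.commute[of _ "h _"] mult.left_commute intro!: mult_right_mono integrable_mult_right\<close>)
  also have "\<dots> = H * exp x" by (simp only: set_integral_mult_right exp_tail_integrals)
  finally show "exp_left_mass h x \<le> H * exp x" .
qed

lemma exp_right_mass_bounds: "0 \<le> exp_right_mass h x" "exp_right_mass h x \<le> H * exp (- x)"
proof -
  show "0 \<le> exp_right_mass h x"
    unfolding exp_right_mass_def set_lebesgue_integral_def using h_nonneg by (intro Bochner_Integration.integral_nonneg) auto
  have "exp_right_mass h x \<le> (LINT y:{x..}|lborel. H * exp (- y))"
    unfolding exp_right_mass_def
    by (rule set_integral_mono[OF integrable_exp_right])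
      (use exp_tail_integrals(1)[of x] h_le in \<open>auto simp: set_integrable_def mult.commute[of _ "h _"] mult.left_commute intro!: mult_right_mono integrable_mult_right\<close>)
  also have "\<dots> = H * exp (- x)" by (simp only: set_integral_mult_right exp_tail_integrals)
  finally show "exp_right_mass h x \<le> H * exp (- x)" .
qed

lemma exp_left_mass_has_derivative: "(exp_left_mass h has_real_derivative exp x * h x) (at x)"
  unfolding exp_left_mass_def[abs_def]
  by (rule set_integral_atMost_has_derivative[OF integrable_exp_left]) (intro continuous_intros cont)

lemma exp_right_mass_has_derivative: "(exp_right_mass h has_real_derivative - (exp (- x) * h x)) (at x)"
  unfolding exp_right_mass_def[abs_def]
  by (rule set_integral_atLeast_has_derivative[OF integrable_exp_right]) (intro continuous_intros cont)

lemma dx_inv_helmholtz_eq: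
  "dx_inv_helmholtz h x = (exp x * exp_right_mass h x - exp (- x) * exp_left_mass h x) / 2"
proof -
  \<comment> \<open>Holds even at \<open>y = x\<close>: there \<open>sgn\<close> is 0, and both
    closed half-lines contain the point, so the two terms on the right cancel.\<close>
  have "- sgn (x - y) * helmholtz_kernel (x - y) * h y =
      exp x / 2 * (indicator {x..} y *\<^sub>R (exp (- y) * h y)) - exp (- x) / 2 * (indicator {..x} y *\<^sub>R (exp y * h y))" for y
    by (cases x y rule: linorder_cases) (auto simp: helmholtz_kernel_def indicator_def exp_diff exp_minus field_simps)
  then have "dx_inv_helmholtz h x = (LINT y|lborel. exp x / 2 * (indicator {x..} y *\<^sub>R (exp (- y) * h y)) - exp (- x) / 2 * (indicator {..x} y *\<^sub>R (exp y * h y)))"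
    unfolding dx_inv_helmholtz_def convolve_def by simp
  also have "\<dots> = exp x / 2 * exp_right_mass h x - exp (- x) / 2 * exp_left_mass h x"
    using integrable_exp_left[of x] integrable_exp_right[of x]
    unfolding set_integrable_def exp_right_mass_def exp_left_mass_def set_lebesgue_integral_def
    by (subst Bochner_Integration.integral_diff) (simp_all only: integrable_mult_right integral_mult_right_zero)
  finally show ?thesis by (simp add: field_simps)
qed

text \<open>The kernel is positive with mass 1: each rescaled one-sided mass lies between 0 and
  \<open>H\<close>, and the value is their average.\<close>

lemma inv_helmholtz_bounds: "0 \<le> inv_helmholtz h x" "inv_helmholtz h x \<le> H"
proof -
  show "0 \<le> inv_helmholtz h x"
    unfolding inv_helmholtz_def using exp_left_mass_bounds(1) exp_right_mass_bounds(1) by simp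
  have e: "exp x * (H * exp (- x)) = H" "exp (- x) * (H * exp x) = H" by (simp_all add: exp_minus)
  have "exp x * exp_right_mass h x \<le> H"
    by (subst e(1)[symmetric], intro mult_left_mono exp_right_mass_bounds(2)) auto
  moreover have "exp (- x) * exp_left_mass h x \<le> H"
    by (subst e(2)[symmetric], intro mult_left_mono exp_left_mass_bounds(2)) auto
  moreover have "(p + q) / 2 \<le> H" if "p \<le> H" "q \<le> H" for p q using that by simp
  ultimately show "inv_helmholtz h x \<le> H" unfolding inv_helmholtz_def by blast
qed

text \<open>The kernel and its derivative have the same modulus, so the difference of the two
  nonnegative halves is dominated by their sum.\<close>

lemma abs_dx_inv_helmholtz_le: "\<bar>dx_inv_helmholtz h x\<bar> \<le> H"
proof -
  have "0 \<le> exp x * exp_right_mass h x" "0 \<le> exp (- x) * exp_left_mass h x"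
    using exp_left_mass_bounds(1) exp_right_mass_bounds(1) by simp_all
  moreover have "\<bar>(p - q) / 2\<bar> \<le> (p + q) / 2" if "0 \<le> p" "0 \<le> q" for p q :: real using that by (simp add: abs_le_iff)
  ultimately have "\<bar>dx_inv_helmholtz h x\<bar> \<le> inv_helmholtz h x"
    unfolding dx_inv_helmholtz_eq inv_helmholtz_def by blast
  then show ?thesis using inv_helmholtz_bounds(2)[of x] by linarith
qed

lemma dx_inv_helmholtz_has_derivative:
  "(dx_inv_helmholtz h has_real_derivative inv_helmholtz h x - h x) (at x)"
proof -
  have e: "- (exp (- x) * h x) * exp x = - h x" "exp x * h x * exp (- x) = h x" by (simp_all add: exp_minus)
  \<comment> \<open>The left side has the shape left behind by the derivative rules, including the
    quotient rule for the constant denominator 2.\<close>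
  have alg: "((p * 1 * q + - k - (r * - 1 * m + k)) * 2 - z * 0) / (2 * 2) = (p * q + r * m) / 2 - k" for p q k r m z :: real
    by (simp add: field_simps)
  show ?thesis
    unfolding dx_inv_helmholtz_eq[abs_def] inv_helmholtz_def
    by (rule derivative_eq_intros exp_left_mass_has_derivative exp_right_mass_has_derivative refl)+
       (simp, simp only: e alg)
qed

lemma dx_inv_helmholtz_lipschitz: "\<bar>dx_inv_helmholtz h x - dx_inv_helmholtz h y\<bar> \<le> H * \<bar>x - y\<bar>"
proof -
  \<comment> \<open>Both terms lie between 0 and \<open>H\<close>, hence the constant is
    \<open>H\<close> and not \<open>2 * H\<close>.\<close>
  have "\<bar>inv_helmholtz h z - h z\<bar> \<le> H" for z
    using inv_helmholtz_bounds[of z] h_nonneg[of z] h_le[of z] by linarith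
  then show ?thesis
    using field_differentiable_bound[of UNIV "dx_inv_helmholtz h" "\<lambda>z. inv_helmholtz h z - h z" H x y]
      dx_inv_helmholtz_has_derivative by simp
qed

text \<open>Both one-sided masses vanish at \<open>c\<close>. The one that reaches over
  \<open>x\<close> is monotone, so it is at most 0 at \<open>x\<close>; if \<open>h x\<close> were
  positive, it would become strictly negative just beyond \<open>x\<close>.\<close>

lemma eq_zero_if_inv_helmholtz_eq_zero:
  assumes "inv_helmholtz h c = 0"
  shows "h x = 0"
proof (rule ccontr)
  assume "h x \<noteq> 0"
  then have pos: "h x > 0" using h_nonneg[of x] by simp
  have "0 \<le> exp c * exp_right_mass h c" "0 \<le> exp (- c) * exp_left_mass h c"
    using exp_left_mass_bounds(1) exp_right_mass_bounds(1) by simp_all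
  with assms have "exp c * exp_right_mass h c = 0" "exp (- c) * exp_left_mass h c = 0"
    unfolding inv_helmholtz_def by (simp_all only: divide_eq_0_iff add_nonneg_eq_0_iff) simp_all
  then have zero: "exp_right_mass h c = 0" "exp_left_mass h c = 0" by simp_all
  show False
  proof (cases "x \<le> c")
    case True
    have "exp_left_mass h x \<le> exp_left_mass h c"
      by (rule DERIV_nonneg_imp_nondecreasing[OF True])
        (use exp_left_mass_has_derivative h_nonneg in \<open>auto intro!: exI\<close>)
    then have "exp_left_mass h x \<le> 0" using zero by simp
    moreover obtain d where "d > 0" "\<And>k. 0 < k \<Longrightarrow> k < d \<Longrightarrow> exp_left_mass h (x - k) < exp_left_mass h x"
      using DERIV_pos_inc_left[OF exp_left_mass_has_derivative[of x]] pos by auto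
    ultimately show False
      using exp_left_mass_bounds(1)[of "x - d / 2"] by (metis field_sum_of_halves half_gt_zero less_add_same_cancel1 not_less order_less_le_trans)
  next
    case False
    then have "exp_right_mass h x \<le> exp_right_mass h c"
      by (intro DERIV_nonpos_imp_nonincreasing[of c x])
        (use exp_right_mass_has_derivative h_nonneg in \<open>auto intro!: exI\<close>)
    then have "exp_right_mass h x \<le> 0" using zero by simp
    moreover obtain d where "d > 0" "\<And>k. 0 < k \<Longrightarrow> k < d \<Longrightarrow> exp_right_mass h (x + k) < exp_right_mass h x"
      using DERIV_neg_dec_right[OF exp_right_mass_has_derivative[of x]] pos by auto
    ultimately show False
      using exp_right_mass_bounds(1)[of "x + d / 2"] by (metis field_sum_of_halves half_gt_zero less_add_same_cancel1 not_less order_less_le_trans)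
  qed
qed

lemma eq_zero_if_dx_inv_helmholtz_eq:
  assumes "a < b" and "\<And>x. x \<in> {a<..<b} \<Longrightarrow> h x = 0" and "dx_inv_helmholtz h a = dx_inv_helmholtz h b"
  shows "h x = 0"
proof -
  obtain z where "a < z" "z < b" "dx_inv_helmholtz h b - dx_inv_helmholtz h a = (b - a) * (inv_helmholtz h z - h z)"
    using MVT2[OF \<open>a < b\<close>, of "dx_inv_helmholtz h" "\<lambda>z. inv_helmholtz h z - h z"] dx_inv_helmholtz_has_derivative by blast
  with assms have "inv_helmholtz h z = 0" by simp
  then show ?thesis by (rule eq_zero_if_inv_helmholtz_eq_zero)
qed

end

subsection \<open>A maximum principle in the space variable\<close>

text \<open>A finite subcover turns locally valid constants into one constant for all times. It
  serves both the radius of decay and the bound \<open>M\<close> on the solution.\<close>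

lemma uniform_on_compact_interval:
  fixes P :: "real \<Rightarrow> real \<Rightarrow> bool"
  assumes loc: "\<And>t. t \<in> {\<alpha>..\<beta>} \<Longrightarrow> \<exists>d>0. \<exists>r. \<forall>\<tau>\<in>{\<alpha>..\<beta>}. \<bar>\<tau> - t\<bar> < d \<longrightarrow> P \<tau> r"
    and mono: "\<And>\<tau> r r'. P \<tau> r \<Longrightarrow> r \<le> r' \<Longrightarrow> P \<tau> r'"
  obtains r where "\<And>\<tau>. \<tau> \<in> {\<alpha>..\<beta>} \<Longrightarrow> P \<tau> r"
proof -
  obtain d r where d: "\<And>t. t \<in> {\<alpha>..\<beta>} \<Longrightarrow> d t > 0"
    and r: "\<And>t \<tau>. t \<in> {\<alpha>..\<beta>} \<Longrightarrow> \<tau> \<in> {\<alpha>..\<beta>} \<Longrightarrow> \<bar>\<tau> - t\<bar> < d t \<Longrightarrow> P \<tau> (r t)"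
    using loc by metis
  have "{\<alpha>..\<beta>} \<subseteq> (\<Union>t\<in>{\<alpha>..\<beta>}. ball t (d t))" using d by force
  then obtain C where C: "C \<subseteq> {\<alpha>..\<beta>}" "finite C" "{\<alpha>..\<beta>} \<subseteq> (\<Union>t\<in>C. ball t (d t))"
    by (rule compactE_image[OF compact_Icc, rotated]) auto
  show ?thesis
  \<comment> \<open>The inserted 0 keeps \<open>Max\<close> meaningful when the interval, and with
    it \<open>C\<close>, is empty.\<close>
  proof (rule that[of "Max (insert 0 (r ` C))"])
    fix \<tau> assume \<tau>: "\<tau> \<in> {\<alpha>..\<beta>}"
    then obtain t where t: "t \<in> C" "\<tau> \<in> ball t (d t)" using C(3) by blast
    then have "P \<tau> (r t)" using r[of t \<tau>] \<tau> C(1) by (auto simp: dist_real_def abs_minus_commute)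
    moreover have "r t \<le> Max (insert 0 (r ` C))" using t C(2) by (intro Max_ge) auto
    ultimately show "P \<tau> (Max (insert 0 (r ` C)))" by (rule mono)
  qed
qed

text \<open>Subtract the penalty \<open>(K + \<epsilon>) * \<bar>t - t0\<bar>\<close>. A violation
  yields a positive maximum, attained by decay, at a time other than \<open>t0\<close>. There
  \<open>W\<close> is maximal in space, so its time derivative is at most \<open>K\<close> in
  modulus, while moving towards \<open>t0\<close> lowers the penalty at rate
  \<open>K + \<epsilon>\<close>: the penalised value would increase. The derivative bound is asked
  only at spatial maxima, since that is where the transport term is under control.\<close>

lemma spatial_maximum_principle:
  fixes W :: "real \<Rightarrow> real \<Rightarrow> real"
  assumes t0: "t0 \<in> {\<alpha>..\<beta>}" and K: "K \<ge> 0"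
    and contx: "\<And>t. t \<in> {\<alpha>..\<beta>} \<Longrightarrow> continuous_on UNIV (W t)"
    and contt: "\<And>t e. t \<in> {\<alpha>..\<beta>} \<Longrightarrow> e > 0 \<Longrightarrow>
       \<exists>d>0. \<forall>\<tau>\<in>{\<alpha>..\<beta>}. \<bar>\<tau> - t\<bar> < d \<longrightarrow> (\<forall>x. \<bar>W \<tau> x - W t x\<bar> < e)"
    and decay: "\<And>t e. t \<in> {\<alpha>..\<beta>} \<Longrightarrow> e > 0 \<Longrightarrow> \<exists>R. \<forall>x. R \<le> \<bar>x\<bar> \<longrightarrow> \<bar>W t x\<bar> < e"
    and init: "\<And>x. W t0 x \<le> 0"
    and deriv: "\<And>t x. t \<in> {\<alpha>..\<beta>} \<Longrightarrow> (\<And>y. W t y \<le> W t x) \<Longrightarrow>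
       \<exists>D. ((\<lambda>\<tau>. W \<tau> x) has_real_derivative D) (at t within {\<alpha>..\<beta>}) \<and> \<bar>D\<bar> \<le> K"
    and t: "t \<in> {\<alpha>..\<beta>}"
  shows "W t x \<le> K * \<bar>t - t0\<bar>"
proof (rule ccontr)
  assume neg: "\<not> ?thesis"
  \<comment> \<open>Half of the excess, divided by \<open>1 + \<bar>t - t0\<bar>\<close>, so that
    the penalised value \<open>m\<close> at the violating point stays positive.\<close>
  define \<epsilon> where "\<epsilon> = (W t x - K * \<bar>t - t0\<bar>) / (1 + \<bar>t - t0\<bar>) / 2"
  have \<epsilon>: "\<epsilon> > 0" using neg unfolding \<epsilon>_def by (intro divide_pos_pos add_pos_nonneg) auto
  define m where "m = W t x - (K + \<epsilon>) * \<bar>t - t0\<bar>"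
  have m: "m > 0"
  proof -
    have "\<epsilon> * \<bar>t - t0\<bar> \<le> \<epsilon> * (1 + \<bar>t - t0\<bar>)" using \<epsilon> by (intro mult_left_mono) auto
    also have "\<dots> = (W t x - K * \<bar>t - t0\<bar>) / 2" using abs_ge_zero[of "t - t0"] unfolding \<epsilon>_def by (simp add: divide_simps del: abs_ge_zero)
    also have "\<dots> < W t x - K * \<bar>t - t0\<bar>" using neg by simp
    finally show ?thesis by (simp add: m_def algebra_simps)
  qed
  \<comment> \<open>Outside this radius \<open>W\<close> stays below \<open>m\<close> at all times,
    so a maximum over a rectangle is global in space.\<close>
  obtain R where R: "\<And>\<tau>. \<tau> \<in> {\<alpha>..\<beta>} \<Longrightarrow> \<forall>y. R \<le> \<bar>y\<bar> \<longrightarrow> \<bar>W \<tau> y\<bar> < m"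
  proof (rule uniform_on_compact_interval[of \<alpha> \<beta> "\<lambda>\<tau> R. \<forall>y. R \<le> \<bar>y\<bar> \<longrightarrow> \<bar>W \<tau> y\<bar> < m"])
    fix t assume t: "t \<in> {\<alpha>..\<beta>}"
    obtain d where d: "d > 0" "\<And>\<tau> x. \<tau> \<in> {\<alpha>..\<beta>} \<Longrightarrow> \<bar>\<tau> - t\<bar> < d \<Longrightarrow> \<bar>W \<tau> x - W t x\<bar> < m / 2"
      using contt[OF t, of "m / 2"] m by auto
    obtain R where R: "\<And>x. R \<le> \<bar>x\<bar> \<Longrightarrow> \<bar>W t x\<bar> < m / 2" using decay[OF t, of "m / 2"] m by auto
    have "\<bar>W \<tau> x\<bar> < m" if "\<tau> \<in> {\<alpha>..\<beta>}" "\<bar>\<tau> - t\<bar> < d" "R \<le> \<bar>x\<bar>" for \<tau> x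
      using d(2)[OF that(1,2), of x] R[OF that(3)] by linarith
    then show "\<exists>d>0. \<exists>R. \<forall>\<tau>\<in>{\<alpha>..\<beta>}. \<bar>\<tau> - t\<bar> < d \<longrightarrow> (\<forall>y. R \<le> \<bar>y\<bar> \<longrightarrow> \<bar>W \<tau> y\<bar> < m)"
      using d(1) by blast
  qed (use order_trans in blast)+
  define r where "r = max R \<bar>x\<bar>"
  define Z where "Z p = W (fst p) (snd p) - (K + \<epsilon>) * \<bar>fst p - t0\<bar>" for p :: "real \<times> real"
  have contW: "continuous_on ({\<alpha>..\<beta>} \<times> {-r..r}) (\<lambda>p. W (fst p) (snd p))"
    unfolding continuous_on_iff
  proof (intro ballI allI impI)
    fix p :: "real \<times> real" and e :: real assume p: "p \<in> {\<alpha>..\<beta>} \<times> {-r..r}" and e: "e > 0"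
    obtain t x where [simp]: "p = (t, x)" by (cases p)
    have t: "t \<in> {\<alpha>..\<beta>}" using p by simp
    obtain d where d: "d > 0" "\<And>\<tau> x. \<tau> \<in> {\<alpha>..\<beta>} \<Longrightarrow> \<bar>\<tau> - t\<bar> < d \<Longrightarrow> \<bar>W \<tau> x - W t x\<bar> < e / 2"
      using contt[OF t, of "e / 2"] e by auto
    obtain d' where d': "d' > 0" "\<And>y. \<bar>y - x\<bar> < d' \<Longrightarrow> \<bar>W t y - W t x\<bar> < e / 2"
      using contx[OF t] e unfolding continuous_on_iff dist_real_def by (meson UNIV_I half_gt_zero)
    show "\<exists>d>0. \<forall>q\<in>{\<alpha>..\<beta>} \<times> {-r..r}. dist q p < d \<longrightarrow> dist (W (fst q) (snd q)) (W (fst p) (snd p)) < e"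
    proof (intro exI[of _ "min d d'"] conjI ballI impI)
      fix q assume q: "q \<in> {\<alpha>..\<beta>} \<times> {-r..r}" and dq: "dist q p < min d d'"
      have "\<bar>fst q - t\<bar> < d" "\<bar>snd q - x\<bar> < d'"
        using dq dist_fst_le[of q p] dist_snd_le[of q p] by (simp_all add: dist_real_def)
      then have "\<bar>W (fst q) (snd q) - W t (snd q)\<bar> < e / 2" "\<bar>W t (snd q) - W t x\<bar> < e / 2"
        using d(2)[of "fst q" "snd q"] d'(2)[of "snd q"] q by (auto simp: mem_Times_iff)
      then show "dist (W (fst q) (snd q)) (W (fst p) (snd p)) < e"
        unfolding dist_real_def \<open>p = (t, x)\<close> fst_conv snd_conv by linarith
    qed (use d d' in auto)
  qed
  have "continuous_on ({\<alpha>..\<beta>} \<times> {-r..r}) Z"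
    unfolding Z_def by (intro continuous_intros contW)
  moreover have tx: "(t, x) \<in> {\<alpha>..\<beta>} \<times> {-r..r}" using t by (auto simp: r_def)
  ultimately obtain p where p: "p \<in> {\<alpha>..\<beta>} \<times> {-r..r}" "\<And>q. q \<in> {\<alpha>..\<beta>} \<times> {-r..r} \<Longrightarrow> Z q \<le> Z p"
    using continuous_attains_sup[OF compact_Times[OF compact_Icc compact_Icc], of \<alpha> \<beta> "-r" r Z] by blast
  obtain \<tau> y where py: "p = (\<tau>, y)" by (cases p)
  have \<tau>: "\<tau> \<in> {\<alpha>..\<beta>}" and y: "y \<in> {-r..r}" using p(1) py by auto
  have Zm: "m \<le> W \<tau> y - (K + \<epsilon>) * \<bar>\<tau> - t0\<bar>" using p(2)[OF tx] by (simp add: Z_def m_def py)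
  have pos: "0 \<le> (K + \<epsilon>) * \<bar>\<tau> - t0\<bar>" using K \<epsilon> by simp
  \<comment> \<open>The penalty is constant in space. Inside the rectangle this is the choice of
    \<open>p\<close>; outside, \<open>W\<close> is below \<open>m\<close>, which
    \<open>W \<tau> y\<close> reaches.\<close>
  have max: "W \<tau> z \<le> W \<tau> y" for z
  proof (cases "z \<in> {-r..r}")
    case True
    then show ?thesis using p(2)[of "(\<tau>, z)"] \<tau> by (simp add: Z_def py)
  next
    case False
    then have "R \<le> \<bar>z\<bar>" by (auto simp: r_def)
    then have "\<bar>W \<tau> z\<bar> < m" using R[OF \<tau>] by blast
    then show ?thesis using Zm pos by linarith
  qed
  obtain D where D: "((\<lambda>\<tau>. W \<tau> y) has_real_derivative D) (at \<tau> within {\<alpha>..\<beta>})" "\<bar>D\<bar> \<le> K"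
    using deriv[OF \<tau> max] by auto
  have "\<tau> \<noteq> t0" using Zm m init[of y] by auto
  then consider "\<tau> > t0" | "\<tau> < t0" by linarith
  then show False
  proof cases
    case 1
    have "((\<lambda>\<sigma>. W \<sigma> y - (K + \<epsilon>) * (\<sigma> - t0)) has_real_derivative D - (K + \<epsilon>)) (at \<tau> within {\<alpha>..\<beta>})"
      by (auto intro!: derivative_eq_intros D(1))
    moreover have "D - (K + \<epsilon>) < 0" using D(2) \<epsilon> by linarith
    ultimately obtain d where d: "d > 0"
      "\<And>h. h > 0 \<Longrightarrow> \<tau> - h \<in> {\<alpha>..\<beta>} \<Longrightarrow> h < d \<Longrightarrow>
         W \<tau> y - (K + \<epsilon>) * (\<tau> - t0) < W (\<tau> - h) y - (K + \<epsilon>) * (\<tau> - h - t0)"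
      using has_real_derivative_neg_dec_left by blast
    \<comment> \<open>A step towards \<open>t0\<close> that does not pass it: this keeps the time in
      the interval and the modulus in the penalty resolved with the same sign.\<close>
    define h where "h = min (d / 2) (\<tau> - t0)"
    have h: "h > 0" "h < d" "h \<le> \<tau> - t0" using d(1) 1 by (auto simp: h_def)
    then have "\<tau> - h \<in> {\<alpha>..\<beta>}" using t0 \<tau> by auto
    then show False using d(2)[OF h(1) _ h(2)] p(2)[of "(\<tau> - h, y)"] y h 1
      by (simp add: Z_def py)
  next
    case 2
    have "((\<lambda>\<sigma>. W \<sigma> y - (K + \<epsilon>) * (t0 - \<sigma>)) has_real_derivative D + (K + \<epsilon>)) (at \<tau> within {\<alpha>..\<beta>})"
      by (auto intro!: derivative_eq_intros D(1))
    moreover have "D + (K + \<epsilon>) > 0" using D(2) \<epsilon> by linarith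
    ultimately obtain d where d: "d > 0"
      "\<And>h. h > 0 \<Longrightarrow> \<tau> + h \<in> {\<alpha>..\<beta>} \<Longrightarrow> h < d \<Longrightarrow>
         W \<tau> y - (K + \<epsilon>) * (t0 - \<tau>) < W (\<tau> + h) y - (K + \<epsilon>) * (t0 - (\<tau> + h))"
      using has_real_derivative_pos_inc_right by blast
    define h where "h = min (d / 2) (t0 - \<tau>)"
    have h: "h > 0" "h < d" "h \<le> t0 - \<tau>" using d(1) 2 by (auto simp: h_def)
    then have "\<tau> + h \<in> {\<alpha>..\<beta>}" using t0 \<tau> by auto
    then show False using d(2)[OF h(1) _ h(2)] p(2)[of "(\<tau> + h, y)"] y h 2
      by (simp add: Z_def py)
  qed
qed

lemma spatial_extremum_principle:
  fixes W :: "real \<Rightarrow> real \<Rightarrow> real"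
  assumes t0: "t0 \<in> {\<alpha>..\<beta>}" and K: "K \<ge> 0"
    and contx: "\<And>t. t \<in> {\<alpha>..\<beta>} \<Longrightarrow> continuous_on UNIV (W t)"
    and contt: "\<And>t e. t \<in> {\<alpha>..\<beta>} \<Longrightarrow> e > 0 \<Longrightarrow>
       \<exists>d>0. \<forall>\<tau>\<in>{\<alpha>..\<beta>}. \<bar>\<tau> - t\<bar> < d \<longrightarrow> (\<forall>x. \<bar>W \<tau> x - W t x\<bar> < e)"
    and decay: "\<And>t e. t \<in> {\<alpha>..\<beta>} \<Longrightarrow> e > 0 \<Longrightarrow> \<exists>R. \<forall>x. R \<le> \<bar>x\<bar> \<longrightarrow> \<bar>W t x\<bar> < e"
    and init: "\<And>x. W t0 x = 0"
    and deriv: "\<And>t x. t \<in> {\<alpha>..\<beta>} \<Longrightarrow> (\<forall>y. W t y \<le> W t x) \<or> (\<forall>y. W t x \<le> W t y) \<Longrightarrow>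
       \<exists>D. ((\<lambda>\<tau>. W \<tau> x) has_real_derivative D) (at t within {\<alpha>..\<beta>}) \<and> \<bar>D\<bar> \<le> K"
    and t: "t \<in> {\<alpha>..\<beta>}"
  shows "\<bar>W t x\<bar> \<le> K * \<bar>t - t0\<bar>"
proof -
  have "W t x \<le> K * \<bar>t - t0\<bar>"
    by (rule spatial_maximum_principle[OF t0 K contx contt decay _ _ t]) (use init deriv in auto)
  moreover have "- W t x \<le> K * \<bar>t - t0\<bar>"
  proof (rule spatial_maximum_principle[OF t0 K _ _ _ _ _ t, of "\<lambda>t x. - W t x"])
    show "continuous_on UNIV (\<lambda>x. - W t x)" if "t \<in> {\<alpha>..\<beta>}" for t
      using contx[OF that] by (rule continuous_on_minus)
    show "\<exists>d>0. \<forall>\<tau>\<in>{\<alpha>..\<beta>}. \<bar>\<tau> - t\<bar> < d \<longrightarrow> (\<forall>x. \<bar>- W \<tau> x - - W t x\<bar> < e)" if "t \<in> {\<alpha>..\<beta>}" "e > 0" for t e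
      using contt[OF that] by (simp add: abs_minus_commute)
    show "\<exists>R. \<forall>x. R \<le> \<bar>x\<bar> \<longrightarrow> \<bar>- W t x\<bar> < e" if "t \<in> {\<alpha>..\<beta>}" "e > 0" for t e
      using decay[OF that] by simp
    show "- W t0 x \<le> 0" for x by (simp add: init)
    fix t x assume t: "t \<in> {\<alpha>..\<beta>}" and "\<And>y. - W t y \<le> - W t x"
    then obtain D where "((\<lambda>\<tau>. W \<tau> x) has_real_derivative D) (at t within {\<alpha>..\<beta>})" "\<bar>D\<bar> \<le> K"
      using deriv[OF t, of x] by auto
    then show "\<exists>D. ((\<lambda>\<tau>. - W \<tau> x) has_real_derivative D) (at t within {\<alpha>..\<beta>}) \<and> \<bar>D\<bar> \<le> K"
      by (intro exI[of _ "- D"]) (auto intro: derivative_intros)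
  qed
  ultimately show ?thesis by linarith
qed

lemma abs_deriv_le_if_difference_quotient_le:
  fixes v :: "real \<Rightarrow> real"
  assumes "(v has_real_derivative D) (at x)" and "\<And>\<delta>. \<delta> > 0 \<Longrightarrow> \<bar>(v (x + \<delta>) - v x) / \<delta>\<bar> \<le> c"
  shows "\<bar>D\<bar> \<le> c"
proof (rule tendsto_upperbound)
  have "((\<lambda>\<delta>. (v (x + \<delta>) - v x) / \<delta>) \<longlongrightarrow> D) (at_right 0)"
    using assms(1) unfolding DERIV_def by (rule filterlim_mono) (auto simp: at_within_le_at)
  then show "((\<lambda>\<delta>. \<bar>(v (x + \<delta>) - v x) / \<delta>\<bar>) \<longlongrightarrow> \<bar>D\<bar>) (at_right 0)" by (rule tendsto_rabs)
  show "\<forall>\<^sub>F \<delta> in at_right 0. \<bar>(v (x + \<delta>) - v x) / \<delta>\<bar> \<le> c"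
    unfolding eventually_at_right_field using assms(2) zero_less_one by blast
qed simp

lemma deriv_eq_zero_at_extremum:
  fixes v :: "real \<Rightarrow> real"
  assumes "(v has_real_derivative D) (at x)" and "(\<forall>y. v y \<le> v x) \<or> (\<forall>y. v x \<le> v y)"
  shows "D = 0"
  using assms(2) DERIV_local_max[OF assms(1) zero_less_one] DERIV_local_min[OF assms(1) zero_less_one] by blast

subsection \<open>Propagation of vanishing\<close>

text \<open>Keeps only classical sup-norm information, so that no Sobolev theory enters the
  propagation argument. \<open>M\<close> bounds \<open>u\<close> and its slope for all times;
  \<open>L\<close> bounds the second derivative of \<open>f\<close> and the growth of
  \<open>g\<close> on \<open>{-M..M}\<close>.\<close>

locale regular_solution =
  fixes f g :: "real \<Rightarrow> real" and u :: "real \<Rightarrow> real \<Rightarrow> real" and T M L :: real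
  assumes f''_nonneg: "\<And>z. 0 \<le> deriv (deriv f) z"
    and f''_cont: "continuous_on UNIV (deriv (deriv f))"
    and f'_deriv: "\<And>z. (deriv f has_real_derivative deriv (deriv f) z) (at z)"
    and g_nonneg: "\<And>z. 0 \<le> g z"
    and g_cont: "continuous_on UNIV g"
    and f''_le: "\<And>z. \<bar>z\<bar> \<le> M \<Longrightarrow> deriv (deriv f) z \<le> L"
    and g_le: "\<And>z. \<bar>z\<bar> \<le> M \<Longrightarrow> g z \<le> L * \<bar>z\<bar>"
    and L_pos: "L > 0" and M_nonneg: "M \<ge> 0"
    and ux: "\<And>t x. t \<in> {0..T} \<Longrightarrow> (u t has_real_derivative deriv (u t) x) (at x)"
    and ux_cont: "\<And>t. t \<in> {0..T} \<Longrightarrow> continuous_on UNIV (deriv (u t))"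
    and u_le: "\<And>t x. t \<in> {0..T} \<Longrightarrow> \<bar>u t x\<bar> \<le> M"
    and ux_le: "\<And>t x. t \<in> {0..T} \<Longrightarrow> \<bar>deriv (u t) x\<bar> \<le> M"
    and u_decay: "\<And>t e. t \<in> {0..T} \<Longrightarrow> e > 0 \<Longrightarrow> \<exists>R. \<forall>x. R \<le> \<bar>x\<bar> \<longrightarrow> \<bar>u t x\<bar> < e"
    and u_sup_cont: "\<And>t e. t \<in> {0..T} \<Longrightarrow> e > 0 \<Longrightarrow>
       \<exists>d>0. \<forall>\<tau>\<in>{0..T}. \<bar>\<tau> - t\<bar> < d \<longrightarrow> (\<forall>x. \<bar>u \<tau> x - u t x\<bar> < e)"
    and solves: "solves_equation f g T u"
begin

lemma u_cont: "t \<in> {0..T} \<Longrightarrow> continuous_on UNIV (u t)"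
  using ux by (meson DERIV_isCont continuous_at_imp_continuous_on)

lemma h_term_cont: "t \<in> {0..T} \<Longrightarrow> continuous_on UNIV (h_term f g (u t))"
  unfolding h_term_def[abs_def]
  by (intro continuous_intros ux_cont continuous_on_compose2[OF g_cont u_cont] continuous_on_compose2[OF f''_cont u_cont]) auto

lemma h_term_nonneg: "0 \<le> h_term f g v x"
  unfolding h_term_def using f''_nonneg g_nonneg by simp

text \<open>Linear in \<open>m\<close> although the slope enters squared: one of its two factors is
  absorbed into \<open>M\<close>. This homogeneity lets the bound be iterated.\<close>

lemma h_term_le:
  assumes t: "t \<in> {0..T}" and m: "\<bar>u t x\<bar> \<le> m" "\<bar>deriv (u t) x\<bar> \<le> m"
  shows "h_term f g (u t) x \<le> L * (1 + M) * m"
proof -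
  have "g (u t x) \<le> L * \<bar>u t x\<bar>" by (rule g_le[OF u_le[OF t]])
  also have "\<dots> \<le> L * m" using L_pos m by (intro mult_left_mono) auto
  finally have 1: "g (u t x) \<le> L * m" .
  have "(deriv (u t) x)\<^sup>2 = \<bar>deriv (u t) x\<bar> * \<bar>deriv (u t) x\<bar>" by (simp add: power2_eq_square)
  also have "\<dots> \<le> M * m" using ux_le[OF t] m M_nonneg by (intro mult_mono) auto
  finally have "deriv (deriv f) (u t x) / 2 * (deriv (u t) x)\<^sup>2 \<le> L * (M * m)"
    using f''_le[OF u_le[OF t], of x] f''_nonneg[of "u t x"] L_pos by (intro mult_mono) auto
  with 1 show ?thesis by (simp add: h_term_def algebra_simps)
qed

lemma u_time_derivative:
  assumes "t \<in> {0..T}"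
  shows "((\<lambda>\<tau>. u \<tau> x) has_real_derivative - (deriv f (u t x) * deriv (u t) x + F_term f g (u t) x)) (at t within {0..T})"
proof -
  obtain D where "((\<lambda>\<tau>. u \<tau> x) has_real_derivative D) (at t within {0..T})"
    "D + deriv f (u t x) * deriv (u t) x + F_term f g (u t) x = 0"
    using solves assms unfolding solves_equation_def F_term_def by blast
  moreover from this(2) have "D = - (deriv f (u t x) * deriv (u t) x + F_term f g (u t) x)" by linarith
  ultimately show ?thesis by simp
qed

lemma f'_lipschitz:
  assumes "\<bar>p\<bar> \<le> M" "\<bar>q\<bar> \<le> M"
  shows "\<bar>deriv f p - deriv f q\<bar> \<le> L * \<bar>p - q\<bar>"
  using field_differentiable_bound[of "{-M..M}" "deriv f" "deriv (deriv f)" L p q] f'_deriv f''_le f''_nonneg assms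
  by (auto simp: has_field_derivative_at_within abs_le_iff)

text \<open>The transport term drops out at a spatial extremum of \<open>u\<close>. At an extremum of the difference
  quotient of \<open>u\<close> the slopes at the two points agree, so no second derivative of \<open>u\<close> is needed
  to estimate its transport term.\<close>

lemma bound_halves:
  assumes t0: "t0 \<in> {\<alpha>..\<beta>}" and sub: "{\<alpha>..\<beta>} \<subseteq> {0..T}" and init: "\<And>x. u t0 x = 0"
    and short: "\<And>t. t \<in> {\<alpha>..\<beta>} \<Longrightarrow> 2 * L * (1 + M) * \<bar>t - t0\<bar> \<le> 1 / 2"
    and m: "\<And>t x. t \<in> {\<alpha>..\<beta>} \<Longrightarrow> \<bar>u t x\<bar> \<le> m \<and> \<bar>deriv (u t) x\<bar> \<le> m"
    and t: "t \<in> {\<alpha>..\<beta>}"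
  shows "\<bar>u t x\<bar> \<le> m / 2 \<and> \<bar>deriv (u t) x\<bar> \<le> m / 2"
proof -
  define H where "H = L * (1 + M) * m"
  have m0: "m \<ge> 0" using m[OF t, of x] by linarith
  have H0: "H \<ge> 0" using L_pos M_nonneg m0 by (simp add: H_def)
  have hH: "h_term f g (u t) x \<le> H" if "t \<in> {\<alpha>..\<beta>}" for t x
    using h_term_le[of t x m] m[OF that] that sub by (auto simp: H_def)
  have F: "\<bar>F_term f g (u t) x\<bar> \<le> H" "\<bar>F_term f g (u t) x - F_term f g (u t) y\<bar> \<le> H * \<bar>x - y\<bar>"
    if "t \<in> {\<alpha>..\<beta>}" for t x y
  proof -
    have "t \<in> {0..T}" using that sub by auto
    note * = h_term_cont[OF this] h_term_nonneg hH[OF that]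
    show "\<bar>F_term f g (u t) x\<bar> \<le> H" "\<bar>F_term f g (u t) x - F_term f g (u t) y\<bar> \<le> H * \<bar>x - y\<bar>"
      unfolding F_term_def by (rule abs_dx_inv_helmholtz_le[OF *] dx_inv_helmholtz_lipschitz[OF *])+
  qed
  \<comment> \<open>The factor 2 provides one \<open>H\<close> for the nonlocal term and one for the
    transport term of the difference quotient.\<close>
  have half: "2 * H * \<bar>t - t0\<bar> \<le> m / 2"
    using mult_right_mono[OF short[OF t] m0] by (simp add: H_def mult_ac)
  have "\<bar>u t x\<bar> \<le> 2 * H * \<bar>t - t0\<bar>" for x
  proof (rule spatial_extremum_principle[where W=u, OF t0 _ _ _ _ init _ t])
    fix t x assume t: "t \<in> {\<alpha>..\<beta>}" and ext: "(\<forall>y. u t y \<le> u t x) \<or> (\<forall>y. u t x \<le> u t y)"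
    have tT: "t \<in> {0..T}" using t sub by auto
    have "deriv (u t) x = 0" by (rule deriv_eq_zero_at_extremum[OF ux[OF tT] ext])
    with DERIV_subset[OF u_time_derivative[OF tT, of x] sub]
    have "((\<lambda>\<tau>. u \<tau> x) has_real_derivative - F_term f g (u t) x) (at t within {\<alpha>..\<beta>})" by simp
    moreover have "\<bar>- F_term f g (u t) x\<bar> \<le> 2 * H" using F(1)[OF t, of x] H0 by simp
    ultimately show "\<exists>D. ((\<lambda>\<tau>. u \<tau> x) has_real_derivative D) (at t within {\<alpha>..\<beta>}) \<and> \<bar>D\<bar> \<le> 2 * H"
      by blast
  next
    fix t and e :: real assume t: "t \<in> {\<alpha>..\<beta>}" and e: "e > 0"
    then show "\<exists>d>0. \<forall>\<tau>\<in>{\<alpha>..\<beta>}. \<bar>\<tau> - t\<bar> < d \<longrightarrow> (\<forall>x. \<bar>u \<tau> x - u t x\<bar> < e)"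
      using u_sup_cont[of t e] sub by (meson subsetD)
  qed (use u_cont u_decay sub H0 in auto)
  with half have bu: "\<bar>u t x\<bar> \<le> m / 2" for x by (meson order_trans)
  have "\<bar>(u t (x + \<delta>) - u t x) / \<delta>\<bar> \<le> 2 * H * \<bar>t - t0\<bar>" if \<delta>: "\<delta> > 0" for \<delta>
  proof (rule spatial_extremum_principle[where W="\<lambda>t x. (u t (x + \<delta>) - u t x) / \<delta>", OF t0 _ _ _ _ _ _ t])
    show "0 \<le> 2 * H" using H0 by simp
    show "(u t0 (x + \<delta>) - u t0 x) / \<delta> = 0" for x by (simp add: init)
    fix t assume t: "t \<in> {\<alpha>..\<beta>}"
    then have tT: "t \<in> {0..T}" using sub by auto
    show "continuous_on UNIV (\<lambda>x. (u t (x + \<delta>) - u t x) / \<delta>)"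
      using \<delta> by (intro continuous_intros continuous_on_compose2[OF u_cont[OF tT]] u_cont[OF tT]) auto
    show "\<exists>d>0. \<forall>\<tau>\<in>{\<alpha>..\<beta>}. \<bar>\<tau> - t\<bar> < d \<longrightarrow> (\<forall>x. \<bar>(u \<tau> (x + \<delta>) - u \<tau> x) / \<delta> - (u t (x + \<delta>) - u t x) / \<delta>\<bar> < e)"
      if e: "e > 0" for e
    proof -
      \<comment> \<open>The tolerance depends on \<open>\<delta>\<close>, which is harmless:
        \<open>\<delta>\<close> is fixed here, and only the resulting bound
        \<open>2 * H * \<bar>t - t0\<bar>\<close> has to be uniform in it.\<close>
      obtain d where d: "d > 0" "\<And>\<tau> x. \<tau> \<in> {0..T} \<Longrightarrow> \<bar>\<tau> - t\<bar> < d \<Longrightarrow> \<bar>u \<tau> x - u t x\<bar> < e * \<delta> / 2"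
        using u_sup_cont[OF tT, of "e * \<delta> / 2"] e \<delta> by auto
      have "\<bar>(u \<tau> (x + \<delta>) - u \<tau> x) / \<delta> - (u t (x + \<delta>) - u t x) / \<delta>\<bar> < e"
        if "\<tau> \<in> {\<alpha>..\<beta>}" "\<bar>\<tau> - t\<bar> < d" for \<tau> x
      proof -
        have "\<tau> \<in> {0..T}" using that sub by auto
        then have "\<bar>(u \<tau> (x + \<delta>) - u \<tau> x) - (u t (x + \<delta>) - u t x)\<bar> < e * \<delta>"
          using d(2)[of \<tau> x] d(2)[of \<tau> "x + \<delta>"] that(2) by linarith
        then show ?thesis
          using \<delta> by (simp add: diff_divide_distrib[symmetric] abs_divide pos_divide_less_eq)
      qed
      then show ?thesis using d(1) by blast
    qed
    show "\<exists>R. \<forall>x. R \<le> \<bar>x\<bar> \<longrightarrow> \<bar>(u t (x + \<delta>) - u t x) / \<delta>\<bar> < e" if e: "e > 0" for e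
    proof -
      obtain R where R: "\<And>x. R \<le> \<bar>x\<bar> \<Longrightarrow> \<bar>u t x\<bar> < e * \<delta> / 2"
        using u_decay[OF tT, of "e * \<delta> / 2"] e \<delta> by auto
      have "\<bar>(u t (x + \<delta>) - u t x) / \<delta>\<bar> < e" if "R + \<delta> \<le> \<bar>x\<bar>" for x
      proof -
        have "R \<le> \<bar>x\<bar>" "R \<le> \<bar>x + \<delta>\<bar>" using that \<delta> by linarith+
        then have "\<bar>u t (x + \<delta>) - u t x\<bar> < e * \<delta>" using R[of x] R[of "x + \<delta>"] by linarith
        then show ?thesis using \<delta> by (simp add: abs_divide pos_divide_less_eq)
      qed
      then show ?thesis by blast
    qed
    fix x
    assume ext: "(\<forall>y. (u t (y + \<delta>) - u t y) / \<delta> \<le> (u t (x + \<delta>) - u t x) / \<delta>) \<or>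
      (\<forall>y. (u t (x + \<delta>) - u t x) / \<delta> \<le> (u t (y + \<delta>) - u t y) / \<delta>)"
    have "((\<lambda>x. u t (x + \<delta>)) has_real_derivative deriv (u t) (x + \<delta>)) (at x)"
      using ux[OF tT, of "x + \<delta>"] by (simp add: DERIV_shift)
    then have "((\<lambda>x. (u t (x + \<delta>) - u t x) / \<delta>) has_real_derivative (deriv (u t) (x + \<delta>) - deriv (u t) x) / \<delta>) (at x)"
      using \<delta> by (intro DERIV_cdivide DERIV_diff ux[OF tT])
    then have "(deriv (u t) (x + \<delta>) - deriv (u t) x) / \<delta> = 0"
      using ext by (rule deriv_eq_zero_at_extremum)
    then have slope: "deriv (u t) (x + \<delta>) = deriv (u t) x" using \<delta> by simp
    let ?D = "(- (deriv f (u t (x + \<delta>)) * deriv (u t) (x + \<delta>) + F_term f g (u t) (x + \<delta>))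
       - - (deriv f (u t x) * deriv (u t) x + F_term f g (u t) x)) / \<delta>"
    have "((\<lambda>\<tau>. (u \<tau> (x + \<delta>) - u \<tau> x) / \<delta>) has_real_derivative ?D) (at t within {\<alpha>..\<beta>})"
      by (intro DERIV_cdivide DERIV_diff DERIV_subset[OF u_time_derivative[OF tT] sub])
    moreover have "\<bar>?D\<bar> \<le> 2 * H"
    proof -
      have "\<bar>u t (x + \<delta>) - u t x\<bar> \<le> m * \<bar>x + \<delta> - x\<bar>"
        using field_differentiable_bound[of UNIV "u t" "deriv (u t)" m "x + \<delta>" x] ux[OF tT] m[OF t] by simp
      then have "L * \<bar>u t (x + \<delta>) - u t x\<bar> \<le> L * (m * \<delta>)" using L_pos \<delta> by simp
      then have "\<bar>deriv f (u t (x + \<delta>)) - deriv f (u t x)\<bar> \<le> L * (m * \<delta>)"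
        using f'_lipschitz[OF u_le[OF tT] u_le[OF tT], of "x + \<delta>" x] by linarith
      \<comment> \<open>The factor \<open>m\<close> comes from the increment of \<open>u\<close>,
        the factor \<open>M\<close> from the remaining slope; the \<open>\<delta>\<close> cancels
        against the difference quotient.\<close>
      then have "\<bar>deriv f (u t (x + \<delta>)) - deriv f (u t x)\<bar> * \<bar>deriv (u t) x\<bar> \<le> L * (m * \<delta>) * M"
        using ux_le[OF tT] L_pos m0 \<delta> by (intro mult_mono) auto
      also have "\<dots> \<le> H * \<delta>"
        using L_pos m0 \<delta> by (simp add: H_def algebra_simps)
      finally have "\<bar>(deriv f (u t (x + \<delta>)) - deriv f (u t x)) * deriv (u t) x\<bar> \<le> H * \<delta>"
        by (simp add: abs_mult)
      moreover have "\<bar>F_term f g (u t) (x + \<delta>) - F_term f g (u t) x\<bar> \<le> H * \<delta>"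
        using F(2)[OF t, of "x + \<delta>" x] \<delta> by simp
      ultimately have "\<bar>- ((deriv f (u t (x + \<delta>)) - deriv f (u t x)) * deriv (u t) x) - (F_term f g (u t) (x + \<delta>) - F_term f g (u t) x)\<bar> \<le> 2 * H * \<delta>"
        by linarith
      also have "- ((deriv f (u t (x + \<delta>)) - deriv f (u t x)) * deriv (u t) x) - (F_term f g (u t) (x + \<delta>) - F_term f g (u t) x) = ?D * \<delta>"
        unfolding slope
          by (rule trans[OF _ nonzero_eq_divide_eq[THEN iffD1, OF _ refl, symmetric]])
             (use \<delta> in \<open>auto simp: left_diff_distrib\<close>)
      finally show ?thesis using \<delta> by (simp add: abs_mult pos_divide_le_eq)
    qed
    ultimately show "\<exists>D. ((\<lambda>\<tau>. (u \<tau> (x + \<delta>) - u \<tau> x) / \<delta>) has_real_derivative D) (at t within {\<alpha>..\<beta>}) \<and> \<bar>D\<bar> \<le> 2 * H"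
      by blast
  qed
  then have "\<bar>(u t (x + \<delta>) - u t x) / \<delta>\<bar> \<le> m / 2" if "\<delta> > 0" for \<delta>
    using half that by (meson order_trans)
  moreover have "t \<in> {0..T}" using t sub by auto
  ultimately have "\<bar>deriv (u t) x\<bar> \<le> m / 2"
    by (intro abs_deriv_le_if_difference_quotient_le[OF ux])
  with bu show ?thesis by blast
qed

text \<open>The halving applies again on the same interval with the improved bound, so starting from
  \<open>M\<close> the solution is below \<open>M / 2 ^ n\<close> for every
  \<open>n\<close>.\<close>

lemma vanishes_nearby:
  assumes t0: "t0 \<in> {0..T}" and init: "\<And>x. u t0 x = 0"
    and t: "t \<in> {0..T}" and near: "2 * L * (1 + M) * \<bar>t - t0\<bar> \<le> 1 / 2"
  shows "u t x = 0"
proof -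
  define \<alpha> \<beta> where "\<alpha> = min t t0" and "\<beta> = max t t0"
  have sub: "{\<alpha>..\<beta>} \<subseteq> {0..T}" and mem: "t0 \<in> {\<alpha>..\<beta>}" "t \<in> {\<alpha>..\<beta>}"
    using t t0 by (auto simp: \<alpha>_def \<beta>_def)
  have short: "2 * L * (1 + M) * \<bar>\<tau> - t0\<bar> \<le> 1 / 2" if "\<tau> \<in> {\<alpha>..\<beta>}" for \<tau>
  proof -
    have "\<bar>\<tau> - t0\<bar> \<le> \<bar>t - t0\<bar>" using that by (auto simp: \<alpha>_def \<beta>_def)
    then have "2 * L * (1 + M) * \<bar>\<tau> - t0\<bar> \<le> 2 * L * (1 + M) * \<bar>t - t0\<bar>"
      using L_pos M_nonneg by (intro mult_left_mono) auto
    with near show ?thesis by linarith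
  qed
  have "\<bar>u \<tau> x\<bar> \<le> M / 2 ^ n \<and> \<bar>deriv (u \<tau>) x\<bar> \<le> M / 2 ^ n" if "\<tau> \<in> {\<alpha>..\<beta>}" for n \<tau> x
    using that
  proof (induction n arbitrary: \<tau> x)
    case 0
    then show ?case using u_le ux_le sub by auto
  next
    case (Suc n)
    show ?case
      using bound_halves[OF mem(1) sub init short Suc.IH Suc.prems, of x] by (simp add: mult.commute)
  qed
  then have "\<bar>u t x\<bar> \<le> M * (1 / 2) ^ n" for n using mem(2) by (simp add: power_one_over)
  moreover have "(\<lambda>n. M * (1 / 2) ^ n) \<longlonglongrightarrow> M * 0"
    by (intro tendsto_intros LIMSEQ_power_zero) auto
  ultimately have "\<bar>u t x\<bar> \<le> M * 0" by (intro LIMSEQ_le_const) auto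
  then show ?thesis by simp
qed

lemma vanishes_everywhere:
  assumes t0: "t0 \<in> {0..T}" and init: "\<And>x. u t0 x = 0" and t: "t \<in> {0..T}"
  shows "u t x = 0"
proof -
  have step: "\<forall>x. u t x = 0" if "t \<in> {0..T}" "2 * L * (1 + M) * \<bar>t - t0\<bar> \<le> real n / 2" for n t
    using that
  proof (induction n arbitrary: t)
    case 0
    then have "\<bar>t - t0\<bar> \<le> 0" using L_pos M_nonneg by (simp add: mult_le_0_iff)
    then show ?case using init by simp
  next
    case (Suc n)
    \<comment> \<open>The intermediate time \<open>t1\<close> lies at the fraction
      \<open>n / (n + 1)\<close> of the way from \<open>t0\<close> to \<open>t\<close>: the
      induction hypothesis reaches \<open>t1\<close>, and what remains is at most one admissible
      step.\<close>
    define c where "c = real n / real (Suc n)"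
    have c: "0 \<le> c" "c \<le> 1" "1 - c = 1 / real (Suc n)" by (auto simp: c_def field_simps)
    define t1 where "t1 = t0 + c * (t - t0)"
    have t1: "t1 \<in> {0..T}"
    proof -
      have "t1 = (1 - c) *\<^sub>R t0 + c *\<^sub>R t" by (simp add: t1_def algebra_simps)
      also have "\<dots> \<in> {0..T}" using convexD_alt[OF convex_real_interval(5) t0 Suc.prems(1) c(1,2)] .
      finally show ?thesis .
    qed
    have "2 * L * (1 + M) * \<bar>t1 - t0\<bar> = c * (2 * L * (1 + M) * \<bar>t - t0\<bar>)"
      using c by (simp add: t1_def abs_mult)
    also have "\<dots> \<le> c * (real (Suc n) / 2)" using Suc.prems(2) c by (intro mult_left_mono) auto
    also have "\<dots> = real n / 2" by (simp add: c_def)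
    finally have z: "\<forall>x. u t1 x = 0" using Suc.IH t1 by blast
    have "t - t1 = (1 - c) * (t - t0)" by (simp add: t1_def algebra_simps)
    then have "2 * L * (1 + M) * \<bar>t - t1\<bar> = (1 - c) * (2 * L * (1 + M) * \<bar>t - t0\<bar>)"
      using c by (simp add: abs_mult)
    also have "\<dots> \<le> (1 - c) * (real (Suc n) / 2)" using Suc.prems(2) c by (intro mult_left_mono) auto
    also have "\<dots> = 1 / 2" unfolding c(3) by simp
    finally show ?case using vanishes_nearby[OF t1 _ Suc.prems(1)] z by blast
  qed
  obtain n where "2 * (2 * L * (1 + M) * \<bar>t - t0\<bar>) \<le> real n" using real_arch_simple by blast
  then show ?thesis using step[OF t, of n] by simp
qed

end

section \<open>Bounds for smooth functions and the final assembly\<close>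

lemma smooth_has_derivative:
  assumes "smooth f"
  shows "((deriv ^^ n) f has_real_derivative (deriv ^^ Suc n) f z) (at z)"
proof -
  have "(deriv ^^ n) f differentiable at z"
    using assms unfolding smooth_def differentiable_on_def by simp
  then show ?thesis by (simp add: DERIV_deriv_iff_real_differentiable)
qed

lemma smooth_continuous_on:
  assumes "smooth f"
  shows "continuous_on UNIV ((deriv ^^ n) f)"
  using assms unfolding smooth_def by (blast intro: differentiable_imp_continuous_on)

lemma smooth_abs_le_on_interval:
  assumes "smooth f"
  obtains B where "B \<ge> 0" and "\<And>z. \<bar>z\<bar> \<le> M \<Longrightarrow> \<bar>(deriv ^^ n) f z\<bar> \<le> B"
proof -
  have "compact ((deriv ^^ n) f ` {-M..M})"
    by (intro compact_continuous_image continuous_on_subset[OF smooth_continuous_on[OF assms]]) auto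
  then obtain B where "B > 0" "\<forall>y\<in>(deriv ^^ n) f ` {-M..M}. norm y \<le> B"
    using compact_imp_bounded bounded_pos by blast
  then show ?thesis by (intro that[of B]) (auto simp: abs_le_iff)
qed

theorem theorem2p1:
  fixes f g :: "real \<Rightarrow> real" and u :: "real \<Rightarrow> real \<Rightarrow> real" and T s t' a b :: real
  assumes "smooth f" and "smooth g"
    and "f 0 = 0" and "\<forall>x. deriv (deriv f) x \<ge> 0"
    and "\<forall>x. g x \<ge> 0" and "\<forall>x. g x = 0 \<longleftrightarrow> x = 0"
    and "T > 0" and "s > 3 / 2"
    and "continuous_into_sobolev T s u"
    \<comment> \<open>pointwise values refer to the continuous representative of \<open>u(t, \<cdot>)\<close> in \<open>H\<^sup>s\<close>\<close>
    and "\<forall>t\<in>{0..T}. continuous_on UNIV (u t)"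
    and "solves_equation f g T u"
    and "a < b" and "{t'} \<times> {a..b} \<subseteq> {0<..<T} \<times> (UNIV :: real set)"
    and "\<forall>x\<in>{a<..<b}. h_term f g (u t') x = 0"
    and "F_term f g (u t') a = F_term f g (u t') b"
  shows "\<forall>t\<in>{0..T}. \<forall>x. u t x = 0"
proof -
  note s = \<open>s > 3 / 2\<close> and curve = \<open>continuous_into_sobolev T s u\<close>
  have cont: "continuous_on UNIV (u t)" if "t \<in> {0..T}" for t using assms(10) that by blast
  have mem: "u t \<in> sobolev_space s" if "t \<in> {0..T}" for t
    using curve that by (auto simp: continuous_into_sobolev_def)
  note emb = sobolev_embedding[OF s mem cont]
  note unif = continuous_into_sobolev_uniform[OF curve s cont]
  obtain M' where M': "\<And>t. t \<in> {0..T} \<Longrightarrow> \<forall>x. \<bar>u t x\<bar> \<le> M' \<and> \<bar>deriv (u t) x\<bar> \<le> M'"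
  proof (rule uniform_on_compact_interval[of 0 T "\<lambda>t r. \<forall>x. \<bar>u t x\<bar> \<le> r \<and> \<bar>deriv (u t) x\<bar> \<le> r"])
    fix t assume t: "t \<in> {0..T}"
    obtain d where d: "d > 0" "\<And>\<tau> x. \<tau> \<in> {0..T} \<Longrightarrow> \<bar>\<tau> - t\<bar> < d \<Longrightarrow>
        \<bar>u \<tau> x - u t x\<bar> < 1 \<and> \<bar>deriv (u \<tau>) x - deriv (u t) x\<bar> < 1"
      using unif[OF _ t zero_less_one] by blast
    \<comment> \<open>The embedding bounds \<open>u t\<close>; the added 1 covers its deviation from
      nearby \<open>u \<tau>\<close>.\<close>
    let ?r = "sobolev_embedding_const s * sobolev_norm s (u t) + 1"
    have "\<bar>u \<tau> x\<bar> \<le> ?r \<and> \<bar>deriv (u \<tau>) x\<bar> \<le> ?r" if "\<tau> \<in> {0..T}" "\<bar>\<tau> - t\<bar> < d" for \<tau> x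
      using d(2)[OF that, of x] emb(3,4)[OF t t, of x] by linarith
    with d(1) show "\<exists>d>0. \<exists>r. \<forall>\<tau>\<in>{0..T}. \<bar>\<tau> - t\<bar> < d \<longrightarrow> (\<forall>x. \<bar>u \<tau> x\<bar> \<le> r \<and> \<bar>deriv (u \<tau>) x\<bar> \<le> r)"
      by blast
  qed (use order_trans in blast)+
  define M where "M = max M' 0"
  have M: "\<bar>u t x\<bar> \<le> M" "\<bar>deriv (u t) x\<bar> \<le> M" if "t \<in> {0..T}" for t x
    using M'[OF that] by (auto simp: M_def intro: le_max_iff_disj[THEN iffD2])
  obtain B where B: "B \<ge> 0" "\<And>z. \<bar>z\<bar> \<le> M \<Longrightarrow> \<bar>deriv (deriv f) z\<bar> \<le> B"
    using smooth_abs_le_on_interval[OF \<open>smooth f\<close>, of M 2] by (auto simp: numeral_2_eq_2)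
  obtain B' where B': "B' \<ge> 0" "\<And>z. \<bar>z\<bar> \<le> M \<Longrightarrow> \<bar>deriv g z\<bar> \<le> B'"
    using smooth_abs_le_on_interval[OF \<open>smooth g\<close>, of M 1] by auto
  \<comment> \<open>One constant for both nonlinearities, with the 1 for strict positivity.\<close>
  define L where "L = B + B' + 1"
  interpret regular_solution f g u T M L
  proof
    show "continuous_on UNIV (deriv (deriv f))"
      using smooth_continuous_on[OF \<open>smooth f\<close>, of 2] by (simp add: numeral_2_eq_2)
    show "(deriv f has_real_derivative deriv (deriv f) z) (at z)" for z
      using smooth_has_derivative[OF \<open>smooth f\<close>, of 1] by simp
    show "continuous_on UNIV g" using smooth_continuous_on[OF \<open>smooth g\<close>, of 0] by simp
    show "deriv (deriv f) z \<le> L" if "\<bar>z\<bar> \<le> M" for z using B(2)[OF that] B'(1) by (simp add: L_def)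
    show "g z \<le> L * \<bar>z\<bar>" if z: "\<bar>z\<bar> \<le> M" for z
    proof -
      have "norm (g z - g 0) \<le> B' * norm (z - 0)"
      proof (rule field_differentiable_bound[of "{-M..M}" g "deriv g"])
        show "(g has_field_derivative deriv g y) (at y within {-M..M})" for y
          using smooth_has_derivative[OF \<open>smooth g\<close>, of 0 y] by (simp add: has_field_derivative_at_within)
      qed (use z B' in \<open>auto simp: abs_le_iff\<close>)
      \<comment> \<open>Turns the Lipschitz bound into linear growth from the origin, which makes
        the zero solution absorbing.\<close>
      moreover have "g 0 = 0" using assms(6) by simp
      ultimately have "g z \<le> B' * \<bar>z\<bar>" by simp
      also have "\<dots> \<le> L * \<bar>z\<bar>" using B(1) by (intro mult_right_mono) (auto simp: L_def)
      finally show ?thesis .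
    qed
    show "L > 0" "M \<ge> 0" using B(1) B'(1) by (auto simp: L_def M_def)
    show "\<exists>d>0. \<forall>\<tau>\<in>{0..T}. \<bar>\<tau> - t\<bar> < d \<longrightarrow> (\<forall>x. \<bar>u \<tau> x - u t x\<bar> < e)" if "t \<in> {0..T}" "e > 0" for t e
      using unif[OF _ that] by blast
    show "(u t has_real_derivative deriv (u t) x) (at x)" if "t \<in> {0..T}" for t x
      by (rule emb(1)[OF that that])
    show "continuous_on UNIV (deriv (u t))" if "t \<in> {0..T}" for t
      by (rule emb(2)[OF that that])
    show "\<exists>R. \<forall>x. R \<le> \<bar>x\<bar> \<longrightarrow> \<bar>u t x\<bar> < e" if "t \<in> {0..T}" "e > 0" for t e
      by (rule emb(5)[OF that(1) that])
    show "0 \<le> deriv (deriv f) z" "0 \<le> g z" for z using assms(4,5) by blast+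
    show "solves_equation f g T u" by fact
  qed (fact M)+
  \<comment> \<open>The inclusion yields a statement about \<open>t'\<close> because the interval is
    nonempty.\<close>
  have "(t', a) \<in> {t'} \<times> {a..b}" using \<open>a < b\<close> by simp
  with assms(13) have "(t', a) \<in> {0<..<T} \<times> (UNIV :: real set)" by blast
  then have t': "t' \<in> {0..T}" by simp
  have "h_term f g (u t') x = 0" for x
  proof (rule eq_zero_if_dx_inv_helmholtz_eq[OF h_term_cont[OF t'] h_term_nonneg _ \<open>a < b\<close>])
    show "h_term f g (u t') x \<le> L * (1 + M) * M" for x by (rule h_term_le[OF t' M[OF t']])
    show "dx_inv_helmholtz (h_term f g (u t')) a = dx_inv_helmholtz (h_term f g (u t')) b"
      using assms(15) by (simp add: F_term_def)
  qed (use assms(14) in blast)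
  \<comment> \<open>Both summands of \<open>h_term\<close> are nonnegative, so its vanishing forces
    \<open>g (u t' x) = 0\<close>, and \<open>g\<close> vanishes only at 0.\<close>
  moreover have "g (u t' x) \<le> h_term f g (u t') x" for x
    unfolding h_term_def using f''_nonneg by simp
  ultimately have "g (u t' x) = 0" for x using g_nonneg by (metis order_antisym)
  then have "u t' x = 0" for x using assms(6) by blast
  then show ?thesis using vanishes_everywhere[OF t'] by blast
qed

end
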